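(* Under assumptions (A1)-(A3) and (B1)-(B3) listed in the context, for every $\delta>0$ there exists $\alpha^*=\alpha^*(D,K,\delta)>0$ such that for every $\alpha>\alpha^*$ there exist $0<\underline{\beta}<\bar{\beta}$ for which $$\Pi\left(\sum_{k>\lceil\underline{\beta}\log n\rceil}w_k>\frac{1}{n^{1/2+\delta}},\ \sum_{k>\lceil\bar{\beta}\log n\rceil}w_k<\frac{1}{n^{1/2+\delta}}\ \Big|\ X_{1:n}\right)\to1$$ as $n\to\infty$ in $Q^{(\infty)}$-probability.
   Context: Let $D\ge 1$, let $\|\cdot\|$ be the Euclidean norm, and let $f$ be a probability density on $\mathbb{R}^D$ (w.r.t. Lebesgue measure). For a probability measure $P$ on $\mathbb{R}^D$ write $Pf(x)=\int f(x-\theta)\,P(d\theta)$. Prior: $\alpha>0$ is the concentration parameter, $P_0$ is a probability measure on $\Theta\subset\mathbb{R}^D$, and $\Pi$ is the law of the Dirichlet process $P\sim \mathrm{DP}(\alpha,P_0)$ in stick-breaking form, $P=\sum_{k\ge1}w_k\delta_{\theta_k}$, $w_k=v_k\prod_{j=1}^{k-1}(1-v_j)$, $v_k$ i.i.d. $\mathrm{Beta}(1,\alpha)$, $\theta_k$ i.i.d. $P_0$, the two sequences being independent; $\Pi$ is identified with the joint law of $(w_k)_{k\ge1},(\theta_k)_{k\ge1}$. The posterior is $\Pi(B\mid X_{1:n})=\int_B\prod_{i=1}^nPf(X_i)\,\Pi(dP)\big/\int\prod_{i=1}^nPf(X_i)\,\Pi(dP)$. Assumptions: (A1) $X_1,X_2,\dots$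 are i.i.d. from $Q(dx)=P^*f(x)\,dx$, where $P^*=\sum_{k=1}^K w_k^*\delta_{\theta_k^*}$, $K<\infty$, $(w_1^*,\dots,w_K^* )$ is a probability vector, and $P^*$ has exactly $K$ support points (the $\theta_k^*$ are distinct and $w_k^*>0$). (A2) $\Theta\subset\mathbb{R}^D$ is compact and $\theta_k^*\in\Theta$ for all $k=1,\dots,K$. (A3) $P_0$ has a continuous bounded density $p_0$ on $\Theta$ w.r.t. Lebesgue measure, with $p_0(\theta_k^* )>0$ for all $k=1,\dots,K$. (B1) $f\in C^3(\mathbb{R}^D)$ and there is a constant $F$ with $0<f(x)<F$ for all $x$. (B2) There are $R>0$, $\gamma\ge0$ with $\|\nabla\log f(x)\|\le R(1+\|x\|)^\gamma$ and $\|\nabla^2\log f(x)\|\le R(1+\|x\|)^\gamma$ for all $x$, and $\int e^{M\|x\|^\gamma}f(x)\,dx<\infty$ for every $M>0$. (B3) There are $C,r>0$ with $\|\nabla^g f(x)\|\le C(1+\|x\|)^{-(D+r)}$ for all $x$ and $g=1,2,3$. $Q^{(\infty)}$ is the law of the i.i.d. sequence $(X_i)_{i\ge1}$, $X_{1:n}=(X_1,\dots,X_n)$, and $\lceil\cdot\rceil$ is the ceiling function.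
   Formalization: The formal theorem also assumes that Θ fills a positive fraction of the volume of all small balls around each θ*_k (automatic at interior points); with p_0 continuous only on an arbitrary compact Θ the claim fails, e.g. when θ*_k is an isolated point of Θ. *)

theory Defs
  imports "HOL-Probability.Probability"
begin

section \<open>Derivatives as bounded linear maps\<close>

text \<open>
  The \<open>g\<close>-th derivative is the \<open>g\<close>-fold iterate of \<open>Deriv\<close>; its \<open>norm\<close> is the operator norm
  of the corresponding multilinear map (for \<open>g = 1\<close> the Euclidean norm of the gradient, for
  \<open>g = 2\<close> the spectral norm of the Hessian).
\<close>

definition Deriv :: "('a::real_normed_vector \<Rightarrow> 'b::real_normed_vector) \<Rightarrow> 'a \<Rightarrow> ('a \<Rightarrow>\<^sub>L 'b)" where
  "Deriv f x = Blinfun (frechet_derivative f (at x))"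

definition C3 :: "('a::real_normed_vector \<Rightarrow> real) \<Rightarrow> bool" where
  "C3 f \<longleftrightarrow> f differentiable_on UNIV \<and> Deriv f differentiable_on UNIV \<and>
     Deriv (Deriv f) differentiable_on UNIV \<and> continuous_on UNIV (Deriv (Deriv (Deriv f)))"


section \<open>Mixtures\<close>

text \<open>The measure \<open>\<Sum>\<^sub>k\<^sub>\<in>\<^sub>I w\<^sub>k \<delta>(\<theta>\<^sub>k)\<close>, as the image under \<open>\<theta>\<close> of the measure with point masses \<open>w\<^sub>k\<close>.\<close>

definition atomic_measure ::
    "nat set \<Rightarrow> (nat \<Rightarrow> real) \<Rightarrow> (nat \<Rightarrow> 'a::euclidean_space) \<Rightarrow> 'a measure" where
  "atomic_measure I w \<theta> = distr (density (count_space I) (\<lambda>k. ennreal (w k))) borel \<theta>"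

definition mixture :: "('a::euclidean_space \<Rightarrow> real) \<Rightarrow> 'a measure \<Rightarrow> 'a \<Rightarrow> real" where
  "mixture f P x = (\<integral>\<theta>. f (x - \<theta>) \<partial>P)"


section \<open>Dirichlet process prior and posterior\<close>

definition beta_distribution :: "real \<Rightarrow> real \<Rightarrow> real measure" where
  "beta_distribution a b = density lborel
     (\<lambda>x. ennreal (indicator {0<..<1} x * (x powr (a - 1) * (1 - x) powr (b - 1) / Beta a b)))"

text \<open>
  Sequences are indexed from 0: the \<open>k\<close>-th stick of the usual 1-based numbering has index \<open>k - 1\<close>,
  so the sum of the weights over all 1-based \<open>k > m\<close> is \<open>weight_tail w m\<close>.
\<close>

definition stick_weights :: "(nat \<Rightarrow> real) \<Rightarrow> nat \<Rightarrow> real" where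
  "stick_weights v k = v k * (\<Prod>j<k. 1 - v j)"

definition weight_tail :: "(nat \<Rightarrow> real) \<Rightarrow> nat \<Rightarrow> real" where
  "weight_tail w m = (\<Sum>i. w (m + i))"

text \<open>The Dirichlet process, identified with the joint law of the weights and the atoms.\<close>

definition DP_prior ::
    "real \<Rightarrow> 'a::euclidean_space measure \<Rightarrow> ((nat \<Rightarrow> real) \<times> (nat \<Rightarrow> 'a)) measure" where
  "DP_prior \<alpha> P0 =
     distr (PiM UNIV (\<lambda>_. beta_distribution 1 \<alpha>) \<Otimes>\<^sub>M PiM UNIV (\<lambda>_. P0))
           (PiM UNIV (\<lambda>_. borel) \<Otimes>\<^sub>M PiM UNIV (\<lambda>_. borel))
           (\<lambda>(v, \<theta>). (stick_weights v, \<theta>))"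

definition likelihood ::
    "('a::euclidean_space \<Rightarrow> real) \<Rightarrow> (nat \<Rightarrow> 'a) \<Rightarrow> nat \<Rightarrow> (nat \<Rightarrow> real) \<times> (nat \<Rightarrow> 'a) \<Rightarrow> real" where
  "likelihood f X n = (\<lambda>(w, \<theta>). \<Prod>i<n. mixture f (atomic_measure UNIV w \<theta>) (X i))"

definition posterior ::
    "((nat \<Rightarrow> real) \<times> (nat \<Rightarrow> 'a)) measure \<Rightarrow> ('a::euclidean_space \<Rightarrow> real) \<Rightarrow> nat \<Rightarrow> (nat \<Rightarrow> 'a) \<Rightarrow>
     ((nat \<Rightarrow> real) \<times> (nat \<Rightarrow> 'a)) set \<Rightarrow> real" where
  "posterior \<pi> f n X B =
     set_lebesgue_integral \<pi> B (likelihood f X n) / integral\<^sup>L \<pi> (likelihood f X n)"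


section \<open>Convergence in probability to a constant\<close>

definition tendsto_in_probability :: "'s measure \<Rightarrow> (nat \<Rightarrow> 's \<Rightarrow> real) \<Rightarrow> real \<Rightarrow> bool" where
  "tendsto_in_probability M Y c \<longleftrightarrow>
     (\<forall>n. Y n \<in> borel_measurable M) \<and>
     (\<forall>\<epsilon>>0. (\<lambda>n. measure M {x \<in> space M. \<bar>Y n x - c\<bar> > \<epsilon>}) \<longlonglongrightarrow> 0)"


section \<open>Assumptions\<close>

text \<open>The true mixing measure \<open>\<Sum>\<^sub>k\<^sub><\<^sub>K w\<^sub>k \<delta>(\<theta>\<^sub>k)\<close> has exactly \<open>K\<close> support points.\<close>

definition finite_mixing :: "nat \<Rightarrow> (nat \<Rightarrow> real) \<Rightarrow> (nat \<Rightarrow> 'a) \<Rightarrow> bool" where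
  "finite_mixing K w \<theta> \<longleftrightarrow> (\<forall>k<K. w k > 0) \<and> (\<Sum>k<K. w k) = 1 \<and> inj_on \<theta> {..<K}"

text \<open>
  \<open>x\<close> is not a degenerate point of \<open>S\<close>: small balls around \<open>x\<close> meet \<open>S\<close> in a positive fraction of
  their volume. This holds at every interior point of any \<open>S\<close>, and at every point of a convex set
  with nonempty interior. It fails, for example, at isolated points, where the value of a
  Lebesgue density that is only required to be continuous on \<open>S\<close> is arbitrary.
\<close>

definition thick_at :: "'a::euclidean_space set \<Rightarrow> 'a \<Rightarrow> bool" where
  "thick_at S x \<longleftrightarrow> (\<exists>c>0. \<exists>\<epsilon>0>0. \<forall>\<epsilon>. 0 < \<epsilon> \<and> \<epsilon> \<le> \<epsilon>0 \<longrightarrow>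
     c * measure lborel (cball x \<epsilon>) \<le> measure lborel (S \<inter> cball x \<epsilon>))"

definition has_continuous_bounded_density_on ::
    "'a::euclidean_space measure \<Rightarrow> ('a \<Rightarrow> real) \<Rightarrow> 'a set \<Rightarrow> bool" where
  "has_continuous_bounded_density_on P0 p0 \<Theta> \<longleftrightarrow>
     continuous_on \<Theta> p0 \<and> bounded (p0 ` \<Theta>) \<and> (\<forall>\<theta>\<in>\<Theta>. 0 \<le> p0 \<theta>) \<and>
     P0 = density lborel (\<lambda>\<theta>. ennreal (indicator \<Theta> \<theta> * p0 \<theta>))"

definition kernel_C3_bounded :: "('a::euclidean_space \<Rightarrow> real) \<Rightarrow> bool" where
  "kernel_C3_bounded f \<longleftrightarrow> C3 f \<and> (\<exists>F. \<forall>x. 0 < f x \<and> f x < F)"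

text \<open>
  Isabelle's \<open>0 powr 0 = 0\<close> matters below only at \<open>x = 0\<close> inside an integral, hence not at all.
\<close>

definition kernel_log_growth :: "('a::euclidean_space \<Rightarrow> real) \<Rightarrow> bool" where
  "kernel_log_growth f \<longleftrightarrow>
     (\<exists>R>0. \<exists>\<gamma>\<ge>0.
        (\<forall>x. norm (Deriv (\<lambda>y. ln (f y)) x) \<le> R * (1 + norm x) powr \<gamma>) \<and>
        (\<forall>x. norm (Deriv (Deriv (\<lambda>y. ln (f y))) x) \<le> R * (1 + norm x) powr \<gamma>) \<and>
        (\<forall>M>0. integrable lborel (\<lambda>x. exp (M * norm x powr \<gamma>) * f x)))"

definition kernel_derivative_decay :: "('a::euclidean_space \<Rightarrow> real) \<Rightarrow> bool" where
  "kernel_derivative_decay f \<longleftrightarrow>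
     (\<exists>C>0. \<exists>r>0. \<forall>x.
        norm (Deriv f x) \<le> C * (1 + norm x) powr (- (DIM('a) + r)) \<and>
        norm (Deriv (Deriv f) x) \<le> C * (1 + norm x) powr (- (DIM('a) + r)) \<and>
        norm (Deriv (Deriv (Deriv f)) x) \<le> C * (1 + norm x) powr (- (DIM('a) + r)))"

end

theory Submission
  imports Defs
begin

text \<open>
  After \<open>m\<close> sticks the Dirichlet process has distributed all but the mass \<open>\<Prod>j<m. 1 - v j\<close>, which is
  almost surely the tail weight (\<open>weight_tail_stick_weights\<close>, \<open>AE_sticks\<close>). Since \<open>1 - v j\<close> has moments
  \<open>\<alpha> / (\<alpha> + s)\<close>, for \<open>m\<close> of the order \<open>\<beta> * ln n\<close> the remaining mass is a power of \<open>n\<close>, and Chernoff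
  bounds give the prior probability that it is atypical at the level \<open>n powr (- (1 / 2 + \<delta>))\<close>. For
  large \<open>\<beta>\<close> the tail is too heavy with probability smaller than any prescribed power of \<open>n\<close>. For small
  \<open>\<beta>\<close> the tail is too light with probability close to \<open>n powr (- \<alpha> * (1 / 2 + \<delta>))\<close>, and this is the
  critical event (\<open>prob_bad_tail_le\<close>).

  The posterior probability of an event is, up to Markov's inequality, at most its prior probability
  divided by the evidence relative to the true likelihood. The evidence is bounded below by a prior
  neighbourhood of the truth of radius \<open>h = n powr (- 1 / 2)\<close>: \<open>K\<close> atoms in dimension \<open>D\<close>, \<open>K - 1\<close> free
  weights and a tail of size \<open>h\<close> give prior mass of order \<open>h powr (\<alpha> + (K - 1) + D * K)\<close>
  (\<open>prior_mass_and_inverse_ratio\<close>). The tail thus costs only \<open>n powr (- \<alpha> / 2)\<close> in the evidence but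
  \<open>n powr (- \<alpha> * (1 / 2 + \<delta>))\<close> in the critical event, and the difference \<open>\<alpha> * \<delta>\<close> beats the parametric
  cost \<open>((K - 1) + D * K) / 2\<close> as soon as \<open>\<alpha>\<close> is large. This is the threshold for \<open>\<alpha>\<close>, and it depends
  on \<open>D\<close>, \<open>K\<close> and \<open>\<delta>\<close> only.

  The evidence bound rests on the mean of the inverse likelihood ratio \<open>1 / r\<close>. For a mixture in the
  neighbourhood, \<open>u = r - 1\<close> is of order \<open>h\<close> up to a random factor with all moments
  (\<open>mixture_ratio_bounds\<close>, from the growth of the log-gradient of the kernel) and has mean zero. Hence
  the mean of \<open>1 / r = 1 - u + u\<^sup>2 / r\<close> is \<open>1 + O(1 / n)\<close> (\<open>nn_integral_inverse_ratio_le\<close>), and for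
  \<open>n\<close> independent observations it stays bounded. As \<open>y \<ge> 2 a - a\<^sup>2 / y\<close>, an average of likelihood
  ratios whose reciprocals have bounded mean exceeds \<open>n powr (- \<epsilon>)\<close> with probability tending to one
  (\<open>nn_integral_ge_of_inverse\<close>, \<open>iid_posterior_concentration\<close>).
\<close>

section \<open>Posterior concentration for i.i.d. observations\<close>

lemma nn_integral_PiM_prod:
  fixes M :: "'a measure"
  assumes "prob_space M" and g: "\<And>i. i < m \<Longrightarrow> g i \<in> borel_measurable M"
  shows "(\<integral>\<^sup>+\<omega>. (\<Prod>i<m. g i (\<omega> i)) \<partial>PiM (UNIV::nat set) (\<lambda>_. M)) = (\<Prod>i<m. \<integral>\<^sup>+x. g i x \<partial>M)"
proof -
  interpret M: prob_space M by fact
  interpret P: product_prob_space "\<lambda>_::nat. M" UNIV by standard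
  have g': "(\<lambda>\<omega>. \<Prod>i<m. g i (\<omega> i)) \<in> borel_measurable (PiM {..<m} (\<lambda>_. M))"
  proof (intro borel_measurable_prod_ennreal)
    fix i assume "i \<in> {..<m}"
    then show "(\<lambda>\<omega>. g i (\<omega> i)) \<in> borel_measurable (PiM {..<m} (\<lambda>_. M))"
      by (intro measurable_compose[OF measurable_component_singleton[of i] g]) auto
  qed
  have "(\<integral>\<^sup>+\<omega>. (\<Prod>i<m. g i (\<omega> i)) \<partial>PiM UNIV (\<lambda>_. M)) =
     (\<integral>\<^sup>+\<omega>. (\<Prod>i<m. g i (restrict \<omega> {..<m} i)) \<partial>PiM UNIV (\<lambda>_. M))"
    by (intro nn_integral_cong prod.cong) auto
  also have "\<dots> = (\<integral>\<^sup>+\<omega>. (\<Prod>i<m. g i (\<omega> i)) \<partial>distr (PiM UNIV (\<lambda>_. M)) (PiM {..<m} (\<lambda>_. M)) (\<lambda>x. restrict x {..<m}))"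
    by (subst nn_integral_distr) (auto intro!: measurable_restrict_subset g')
  also have "\<dots> = (\<Prod>i<m. \<integral>\<^sup>+x. g i x \<partial>M)"
    by (subst P.distr_PiM_restrict_finite) (auto intro!: P.product_nn_integral_prod g)
  finally show ?thesis .
qed

text \<open>
  Tonelli followed by independence. With \<open>g\<close> a likelihood ratio it bounds posterior numerators in
  mean; with \<open>g\<close> an inverse likelihood ratio it controls how small the evidence can be.
\<close>

lemma nn_integral_iid_product_swap:
  fixes \<Omega> :: "'p measure" and Q :: "'a measure" and g :: "'p \<Rightarrow> 'a \<Rightarrow> ennreal"
  assumes "prob_space Q" "prob_space \<Omega>"
    and g[measurable]: "(\<lambda>(\<omega>, x). g \<omega> x) \<in> borel_measurable (\<Omega> \<Otimes>\<^sub>M Q)"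
    and S[measurable]: "S \<in> sets \<Omega>"
    and le: "AE \<omega> in \<Omega>. \<omega> \<in> S \<longrightarrow> (\<integral>\<^sup>+x. g \<omega> x \<partial>Q) \<le> c"
  shows "(\<integral>\<^sup>+X. (\<integral>\<^sup>+\<omega>\<in>S. (\<Prod>i<n. g \<omega> (X i)) \<partial>\<Omega>) \<partial>PiM (UNIV::nat set) (\<lambda>_. Q)) \<le> c ^ n * emeasure \<Omega> S"
proof -
  interpret Q: prob_space Q by fact
  interpret O: prob_space \<Omega> by fact
  interpret P: product_prob_space "\<lambda>_::nat. Q" UNIV by standard
  interpret PO: pair_sigma_finite "PiM (UNIV::nat set) (\<lambda>_. Q)" \<Omega> ..
  have [measurable]: "(\<lambda>(X, \<omega>). g \<omega> (X i)) \<in> borel_measurable (PiM (UNIV::nat set) (\<lambda>_. Q) \<Otimes>\<^sub>M \<Omega>)" for i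
    by measurable
  have "(\<integral>\<^sup>+X. (\<integral>\<^sup>+\<omega>\<in>S. (\<Prod>i<n. g \<omega> (X i)) \<partial>\<Omega>) \<partial>PiM (UNIV::nat set) (\<lambda>_. Q)) =
     (\<integral>\<^sup>+\<omega>. (\<integral>\<^sup>+X. (\<Prod>i<n. g \<omega> (X i)) * indicator S \<omega> \<partial>PiM (UNIV::nat set) (\<lambda>_. Q)) \<partial>\<Omega>)"
    by (rule PO.Fubini'[symmetric]) measurable
  also have "\<dots> = (\<integral>\<^sup>+\<omega>. (\<integral>\<^sup>+x. g \<omega> x \<partial>Q) ^ n * indicator S \<omega> \<partial>\<Omega>)"
  proof (intro nn_integral_cong)
    fix \<omega> assume w: "\<omega> \<in> space \<Omega>"
    have m: "g \<omega> \<in> borel_measurable Q" using w by measurable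
    have m'[measurable]: "(\<lambda>X. g \<omega> (X i)) \<in> borel_measurable (PiM (UNIV::nat set) (\<lambda>_. Q))" for i
      by (rule measurable_compose[OF measurable_component_singleton[of i UNIV "\<lambda>_. Q"] m]) simp
    have "(\<integral>\<^sup>+X. (\<Prod>i<n. g \<omega> (X i)) * indicator S \<omega> \<partial>PiM (UNIV::nat set) (\<lambda>_. Q)) =
       (\<integral>\<^sup>+X. (\<Prod>i<n. g \<omega> (X i)) \<partial>PiM (UNIV::nat set) (\<lambda>_. Q)) * indicator S \<omega>"
      by (intro nn_integral_multc) measurable
    then show "(\<integral>\<^sup>+X. (\<Prod>i<n. g \<omega> (X i)) * indicator S \<omega> \<partial>PiM (UNIV::nat set) (\<lambda>_. Q)) =
       (\<integral>\<^sup>+x. g \<omega> x \<partial>Q) ^ n * indicator S \<omega>"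
      using m nn_integral_PiM_prod[OF assms(1), of n "\<lambda>_. g \<omega>"] by simp
  qed
  also have "\<dots> \<le> (\<integral>\<^sup>+\<omega>. c ^ n * indicator S \<omega> \<partial>\<Omega>)"
    by (intro nn_integral_mono_AE) (use le in eventually_elim, auto split: split_indicator intro!: power_mono)
  also have "\<dots> = c ^ n * emeasure \<Omega> S" by (simp add: nn_integral_cmult_indicator)
  finally show ?thesis .
qed

text \<open>
  An average is large as soon as the average of the reciprocals is not too large: integrate
  \<open>g \<ge> 2 a - a\<^sup>2 / g\<close>. This replaces the usual Jensen argument for the logarithm of the
  evidence, so that only the mean of \<open>1 / r\<close> has to be controlled.
\<close>

lemma nn_integral_ge_of_inverse:
  fixes g :: "'p \<Rightarrow> real"
  assumes "finite_measure \<Omega>" and [measurable]: "g \<in> borel_measurable \<Omega>" "A \<in> sets \<Omega>"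
    and pos: "AE \<omega> in \<Omega>. \<omega> \<in> A \<longrightarrow> 0 < g \<omega>" and a: "0 < a"
    and inv: "(\<integral>\<^sup>+\<omega>\<in>A. ennreal (1 / g \<omega>) \<partial>\<Omega>) \<le> ennreal (measure \<Omega> A / a)"
  shows "ennreal (a * measure \<Omega> A) \<le> (\<integral>\<^sup>+\<omega>\<in>A. ennreal (g \<omega>) \<partial>\<Omega>)"
proof -
  interpret finite_measure \<Omega> by fact
  let ?m = "measure \<Omega> A"
  have "ennreal (2 * a * ?m) = (\<integral>\<^sup>+\<omega>. ennreal (2 * a) * indicator A \<omega> \<partial>\<Omega>)"
    using a by (simp add: nn_integral_cmult_indicator emeasure_eq_measure ennreal_mult)
  also have "\<dots> \<le> (\<integral>\<^sup>+\<omega>. ennreal (g \<omega>) * indicator A \<omega> + ennreal (a\<^sup>2) * (ennreal (1 / g \<omega>) * indicator A \<omega>) \<partial>\<Omega>)"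
  proof (intro nn_integral_mono_AE, use pos in eventually_elim)
    fix \<omega> assume *: "\<omega> \<in> A \<longrightarrow> 0 < g \<omega>"
    show "ennreal (2 * a) * indicator A \<omega> \<le> ennreal (g \<omega>) * indicator A \<omega> + ennreal (a\<^sup>2) * (ennreal (1 / g \<omega>) * indicator A \<omega>)"
    proof (cases "\<omega> \<in> A")
      case True
      with * have "0 < g \<omega>" by simp
      then have "2 * a \<le> g \<omega> + a\<^sup>2 * (1 / g \<omega>)"
        using zero_le_power2[of "g \<omega> - a"] by (simp add: field_simps power2_eq_square)
      then show ?thesis using True \<open>0 < g \<omega>\<close> a
        by (simp flip: ennreal_plus ennreal_mult)
    qed simp
  qed
  also have "\<dots> = (\<integral>\<^sup>+\<omega>\<in>A. ennreal (g \<omega>) \<partial>\<Omega>) + ennreal (a\<^sup>2) * (\<integral>\<^sup>+\<omega>\<in>A. ennreal (1 / g \<omega>) \<partial>\<Omega>)"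
    by (subst nn_integral_add) (auto intro!: nn_integral_cmult)
  also have "\<dots> \<le> (\<integral>\<^sup>+\<omega>\<in>A. ennreal (g \<omega>) \<partial>\<Omega>) + ennreal (a\<^sup>2) * ennreal (?m / a)"
    by (intro add_left_mono mult_left_mono inv) auto
  also have "ennreal (a\<^sup>2) * ennreal (?m / a) = ennreal (a * ?m)"
    using a by (simp add: power2_eq_square flip: ennreal_mult)
  finally have *: "ennreal (2 * a * ?m) \<le> (\<integral>\<^sup>+\<omega>\<in>A. ennreal (g \<omega>) \<partial>\<Omega>) + ennreal (a * ?m)" .
  show ?thesis
  proof (cases "\<integral>\<^sup>+\<omega>\<in>A. ennreal (g \<omega>) \<partial>\<Omega>" rule: ennreal_cases)
    case (real x)
    then show ?thesis using * a by (simp flip: ennreal_plus)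
  next
    case top
    then show ?thesis by simp
  qed
qed

lemma (in prob_space) prob_Markov:
  assumes [measurable]: "f \<in> borel_measurable M" and b: "(\<integral>\<^sup>+x. f x \<partial>M) \<le> ennreal b" "0 \<le> b" "0 < t"
  shows "prob {x \<in> space M. ennreal t \<le> f x} \<le> b / t"
proof -
  have "ennreal (t * prob {x \<in> space M. ennreal t \<le> f x}) =
      (\<integral>\<^sup>+x. ennreal t * indicator {x \<in> space M. ennreal t \<le> f x} x \<partial>M)"
    using b by (simp add: nn_integral_cmult_indicator emeasure_eq_measure ennreal_mult)
  also have "\<dots> \<le> (\<integral>\<^sup>+x. f x \<partial>M)"
    by (intro nn_integral_mono) (auto split: split_indicator)
  also note b(1)
  finally show ?thesis using b by (simp add: field_simps)
qed

text \<open>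
  With \<open>r \<omega>\<close> the likelihood ratio of parameter \<open>\<omega>\<close> against the true density, the evidence is at least
  \<open>a * measure \<Omega> A\<close> unless the mean of the inverse likelihood ratio over \<open>A\<close> exceeds
  \<open>measure \<Omega> A / a\<close>, and the numerator of \<open>B\<close> has mean at most \<open>measure \<Omega> B\<close>. Markov's inequality for
  both gives the two terms of the bound.
\<close>

lemma iid_posterior_concentration:
  fixes \<Omega> :: "'p measure" and Q :: "'a measure" and r :: "'p \<Rightarrow> 'a \<Rightarrow> real"
  assumes Q: "prob_space Q" and O: "prob_space \<Omega>"
    and r[measurable]: "(\<lambda>(\<omega>, x). r \<omega> x) \<in> borel_measurable (\<Omega> \<Otimes>\<^sub>M Q)"
    and A[measurable]: "A \<in> sets \<Omega>" and B[measurable]: "B \<in> sets \<Omega>"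
    and r_nonneg: "\<And>\<omega> x. 0 \<le> r \<omega> x"
    and r1: "AE \<omega> in \<Omega>. (\<integral>\<^sup>+x. ennreal (r \<omega> x) \<partial>Q) \<le> 1"
    and rpos: "AE \<omega> in \<Omega>. \<omega> \<in> A \<longrightarrow> (\<forall>x. 0 < r \<omega> x)"
    and rinv: "AE \<omega> in \<Omega>. \<omega> \<in> A \<longrightarrow> (\<integral>\<^sup>+x. ennreal (1 / r \<omega> x) \<partial>Q) \<le> ennreal c"
    and pos: "0 < measure \<Omega> A" "0 < a" "0 < \<eta>" "0 \<le> c"
    and E: "E \<subseteq> {X \<in> space (PiM (UNIV::nat set) (\<lambda>_. Q)).
       \<not> ((\<integral>\<^sup>+\<omega>\<in>B. ennreal (\<Prod>i<n. r \<omega> (X i)) \<partial>\<Omega>) < ennreal \<eta> * (\<integral>\<^sup>+\<omega>. ennreal (\<Prod>i<n. r \<omega> (X i)) \<partial>\<Omega>))}"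
  shows "measure (PiM (UNIV::nat set) (\<lambda>_. Q)) E \<le> measure \<Omega> B / (\<eta> * a * measure \<Omega> A) + a * c ^ n"
proof -
  interpret Q: prob_space Q by fact
  interpret O: prob_space \<Omega> by fact
  let ?M = "PiM (UNIV::nat set) (\<lambda>_. Q)"
  interpret P: product_prob_space "\<lambda>_::nat. Q" UNIV by standard
  let ?N = "\<lambda>X. \<integral>\<^sup>+\<omega>\<in>B. (\<Prod>i<n. ennreal (r \<omega> (X i))) \<partial>\<Omega>"
  let ?I = "\<lambda>X. \<integral>\<^sup>+\<omega>\<in>A. (\<Prod>i<n. ennreal (1 / r \<omega> (X i))) \<partial>\<Omega>"
  let ?D = "\<lambda>X. \<integral>\<^sup>+\<omega>. (\<Prod>i<n. ennreal (r \<omega> (X i))) \<partial>\<Omega>"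
  have [measurable]: "(\<lambda>(X, \<omega>). r \<omega> (X i)) \<in> borel_measurable (?M \<Otimes>\<^sub>M \<Omega>)" for i
    by measurable
  define t1 where "t1 = \<eta> * a * measure \<Omega> A"
  define t2 where "t2 = measure \<Omega> A / a"
  have t: "t1 > 0" "t2 > 0" unfolding t1_def t2_def using pos by auto
  have N: "(\<integral>\<^sup>+X. ?N X \<partial>?M) \<le> ennreal (measure \<Omega> B)"
  proof -
    have "AE \<omega> in \<Omega>. \<omega> \<in> B \<longrightarrow> (\<integral>\<^sup>+x. ennreal (r \<omega> x) \<partial>Q) \<le> 1"
      using r1 by eventually_elim simp
    from nn_integral_iid_product_swap[OF Q O _ B this, of n] show ?thesis
      by (simp add: O.emeasure_eq_measure)
  qed
  have I: "(\<integral>\<^sup>+X. ?I X \<partial>?M) \<le> ennreal (c ^ n * measure \<Omega> A)"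
    using nn_integral_iid_product_swap[OF Q O _ A rinv, of n] pos
    by (simp add: O.emeasure_eq_measure ennreal_mult ennreal_power)
  have MN: "measure ?M {X\<in>space ?M. ennreal t1 \<le> ?N X} \<le> measure \<Omega> B / t1"
    by (rule prob_space.prob_Markov[OF P.prob_space_axioms _ N]) (use t in auto)
  have MI: "measure ?M {X\<in>space ?M. ennreal t2 \<le> ?I X} \<le> (c ^ n * measure \<Omega> A) / t2"
    by (rule prob_space.prob_Markov[OF P.prob_space_axioms _ I]) (use t pos in auto)
  let ?G = "{X \<in> space ?M. \<not> ((\<integral>\<^sup>+\<omega>\<in>B. ennreal (\<Prod>i<n. r \<omega> (X i)) \<partial>\<Omega>) < ennreal \<eta> * (\<integral>\<^sup>+\<omega>. ennreal (\<Prod>i<n. r \<omega> (X i)) \<partial>\<Omega>))}"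
  have "?G \<subseteq> {X\<in>space ?M. ennreal t1 \<le> ?N X} \<union> {X\<in>space ?M. ennreal t2 \<le> ?I X}"
  proof safe
    fix X assume X: "X \<in> space ?M" and I: "\<not> ennreal t2 \<le> ?I X"
      and G: "\<not> ((\<integral>\<^sup>+\<omega>\<in>B. ennreal (\<Prod>i<n. r \<omega> (X i)) \<partial>\<Omega>) < ennreal \<eta> * (\<integral>\<^sup>+\<omega>. ennreal (\<Prod>i<n. r \<omega> (X i)) \<partial>\<Omega>))"
    have [measurable]: "(\<lambda>\<omega>. r \<omega> (X i)) \<in> borel_measurable \<Omega>" for i
    proof -
      have [measurable]: "(\<lambda>_. X i) \<in> measurable \<Omega> Q"
      proof (rule measurable_const)
        show "X i \<in> space Q" using X by (auto simp: space_PiM PiE_iff)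
      qed
      show ?thesis by measurable
    qed
    have "ennreal (a * measure \<Omega> A) \<le> (\<integral>\<^sup>+\<omega>\<in>A. ennreal (\<Prod>i<n. r \<omega> (X i)) \<partial>\<Omega>)"
    proof (rule nn_integral_ge_of_inverse)
      show "AE \<omega> in \<Omega>. \<omega> \<in> A \<longrightarrow> 0 < (\<Prod>i<n. r \<omega> (X i))"
        using rpos by eventually_elim (auto intro!: prod_pos)
      have "(\<integral>\<^sup>+\<omega>\<in>A. ennreal (1 / (\<Prod>i<n. r \<omega> (X i))) \<partial>\<Omega>) = ?I X"
        by (intro nn_integral_cong arg_cong2[where f="(*)"]) (auto simp: prod_ennreal r_nonneg prod_dividef)
      with I show "(\<integral>\<^sup>+\<omega>\<in>A. ennreal (1 / (\<Prod>i<n. r \<omega> (X i))) \<partial>\<Omega>) \<le> ennreal (measure \<Omega> A / a)"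
        unfolding t2_def by (simp add: not_le less_imp_le)
    qed (use pos O.finite_measure_axioms in measurable)
    also have "\<dots> \<le> ?D X"
      by (intro nn_integral_mono) (auto simp: prod_ennreal r_nonneg split: split_indicator)
    finally have "ennreal t1 \<le> ennreal \<eta> * ?D X"
      using pos by (auto simp: t1_def mult.assoc ennreal_mult intro!: mult_left_mono)
    also have "\<dots> \<le> ?N X"
      using G by (simp add: prod_ennreal r_nonneg not_less)
    finally show "ennreal t1 \<le> ?N X" .
  qed
  with E have "E \<subseteq> {X\<in>space ?M. ennreal t1 \<le> ?N X} \<union> {X\<in>space ?M. ennreal t2 \<le> ?I X}"
    by blast
  then have "measure ?M E \<le> measure ?M ({X\<in>space ?M. ennreal t1 \<le> ?N X} \<union> {X\<in>space ?M. ennreal t2 \<le> ?I X})"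
    by (intro P.finite_measure_mono) auto
  also have "\<dots> \<le> measure ?M {X\<in>space ?M. ennreal t1 \<le> ?N X} + measure ?M {X\<in>space ?M. ennreal t2 \<le> ?I X}"
    by (intro measure_Un_le) auto
  also have "\<dots> \<le> measure \<Omega> B / t1 + (c ^ n * measure \<Omega> A) / t2"
    using MN MI by simp
  also have "\<dots> = measure \<Omega> B / (\<eta> * a * measure \<Omega> A) + a * c ^ n"
    using pos unfolding t1_def t2_def by simp
  finally show ?thesis .
qed

section \<open>Stick breaking\<close>

lemma sum_stick_weights:
  "(\<Sum>i<N. stick_weights v (m + i)) = (\<Prod>j<m. 1 - v j) - (\<Prod>j<m + N. 1 - v j)"
  by (induction N) (simp_all add: stick_weights_def algebra_simps)

lemma stick_weights_sums:
  assumes "(\<lambda>m. \<Prod>j<m. 1 - v j) \<longlonglongrightarrow> 0"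
  shows "(\<lambda>i. stick_weights v (m + i)) sums (\<Prod>j<m. 1 - v j)"
proof -
  have "(\<lambda>N. \<Prod>j<m + N. 1 - v j) \<longlonglongrightarrow> 0"
    using LIMSEQ_ignore_initial_segment[OF assms, of m] by (simp add: add.commute)
  from tendsto_diff[OF tendsto_const this, of "\<Prod>j<m. 1 - v j"] show ?thesis
    by (simp add: sums_def sum_stick_weights)
qed

lemma weight_tail_stick_weights:
  assumes "(\<lambda>m. \<Prod>j<m. 1 - v j) \<longlonglongrightarrow> 0"
  shows "weight_tail (stick_weights v) m = (\<Prod>j<m. 1 - v j)"
  unfolding weight_tail_def using stick_weights_sums[OF assms] by (rule sums_unique[symmetric])

lemma stick_weights_nonneg:
  assumes "\<And>j. 0 \<le> v j" "\<And>j. v j \<le> 1"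
  shows "0 \<le> stick_weights v k"
  unfolding stick_weights_def using assms by (intro mult_nonneg_nonneg prod_nonneg) auto

text \<open>
  A weight is a product of factors in \<open>[-1, 1]\<close>, so it is Lipschitz in each stick proportion.
\<close>

lemma stick_weights_diff_le:
  assumes v: "\<And>j. j \<le> k \<Longrightarrow> \<bar>v j\<bar> \<le> 1 \<and> \<bar>1 - v j\<bar> \<le> 1"
    and u: "\<And>j. j \<le> k \<Longrightarrow> \<bar>u j\<bar> \<le> 1 \<and> \<bar>1 - u j\<bar> \<le> 1"
    and h: "\<And>j. j \<le> k \<Longrightarrow> \<bar>v j - u j\<bar> \<le> h"
  shows "\<bar>stick_weights v k - stick_weights u k\<bar> \<le> (real k + 1) * h"
proof -
  let ?F = "\<lambda>v j. if j = k then v k else 1 - v j :: real"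
  have F: "stick_weights v k = (\<Prod>j<Suc k. ?F v j)" for v
    unfolding stick_weights_def prod.lessThan_Suc by (simp add: mult.commute)
  have "norm ((\<Prod>j<Suc k. ?F v j) - (\<Prod>j<Suc k. ?F u j)) \<le> (\<Sum>j<Suc k. norm (?F v j - ?F u j))"
    by (intro norm_prod_diff) (use u v in auto)
  also have "\<dots> \<le> (\<Sum>j<Suc k. h)"
    by (intro sum_mono) (use h in \<open>force simp: abs_minus_commute\<close>)
  also have "\<dots> = (real k + 1) * h" by (simp add: algebra_simps)
  finally show ?thesis by (simp only: F real_norm_def)
qed

text \<open>
  Every probability vector with positive entries comes from sticks; the last stick takes all that
  is left. Prior mass near the true weights is computed in these coordinates, where the prior is a
  product.
\<close>

lemma stick_representation:
  fixes w :: "nat \<Rightarrow> real"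
  assumes pos: "\<And>k. k < K \<Longrightarrow> 0 < w k" and one: "(\<Sum>k<K. w k) = 1"
  obtains u where "\<And>k. k < K \<Longrightarrow> stick_weights u k = w k" "\<And>k. k < K \<Longrightarrow> 0 < u k"
    "\<And>k. Suc k < K \<Longrightarrow> u k < 1" "\<And>k. Suc k = K \<Longrightarrow> u k = 1"
proof
  \<comment> \<open>The proportion \<open>u k\<close> is \<open>w k\<close> relative to the mass \<open>S k\<close> still unassigned before stick \<open>k\<close>.\<close>
  define S where "S k = (\<Sum>j\<in>{k..<K}. w j)" for k
  define u where "u k = w k / S k" for k
  have S: "S k = w k + S (Suc k)" if "k < K" for k
    unfolding S_def using that by (simp add: sum.atLeast_Suc_lessThan)
  have Spos: "S k > 0" if "k < K" for k
    unfolding S_def using that pos by (intro sum_pos) auto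
  have S0: "S 0 = 1" unfolding S_def using one by (simp add: lessThan_atLeast0)
  have SK: "S K = 0" unfolding S_def by simp
  have "1 - u k = S (Suc k) / S k" if "k < K" for k
    using S[OF that] Spos[OF that] unfolding u_def by (simp add: field_simps)
  then have P: "k \<le> K \<Longrightarrow> (\<Prod>j<k. 1 - u j) = S k" for k
    using Spos by (induction k) (auto simp: S0 less_imp_neq[symmetric])
  show "stick_weights u k = w k" if "k < K" for k
    using P[of k] Spos[of k] that unfolding stick_weights_def u_def by simp
  show "0 < u k" if "k < K" for k
    unfolding u_def using pos Spos that by simp
  show "u k < 1" if "Suc k < K" for k
    using S[of k] Spos[of k] Spos[of "Suc k"] that unfolding u_def by simp
  show "u k = 1" if "Suc k = K" for k
    using S[of k] Spos[of k] that SK unfolding u_def by auto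
qed

section \<open>The stick proportions\<close>

lemma Beta_1_left:
  fixes t :: real
  assumes "0 < t" shows "Beta 1 t = 1 / t"
proof -
  have "Gamma (t + 1) = t * Gamma t"
    using assms by (intro Gamma_plus1) auto
  moreover have "Gamma t \<noteq> 0" using Gamma_real_pos[OF assms] by simp
  ultimately show ?thesis unfolding Beta_def using assms by (simp add: add.commute)
qed

lemma nn_integral_beta_1_powr:
  assumes a: "0 < \<alpha>" and s: "0 < \<alpha> + s"
  shows "(\<integral>\<^sup>+x. ennreal ((1 - x) powr s) \<partial>beta_distribution 1 \<alpha>) = ennreal (\<alpha> / (\<alpha> + s))"
proof -
  let ?g = "\<lambda>x::real. x powr (1 - 1) * (1 - x) powr (\<alpha> + s - 1)"
  have "(?g has_integral Beta 1 (\<alpha> + s)) {0..1}"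
    using s by (intro has_integral_Beta_real) auto
  then have g: "(?g has_integral (1 / (\<alpha> + s))) {0<..<1}"
    using Beta_1_left[OF s] by (simp add: has_integral_Icc_iff_Ioo)
  have "(\<integral>\<^sup>+x. ennreal ((1 - x) powr s) \<partial>beta_distribution 1 \<alpha>) =
     (\<integral>\<^sup>+x. ennreal (indicator {0<..<1} x * (x powr (1 - 1) * (1 - x) powr (\<alpha> - 1) / Beta 1 \<alpha>)) * ennreal ((1 - x) powr s) \<partial>lborel)"
    unfolding beta_distribution_def by (subst nn_integral_density) auto
  also have "\<dots> = (\<integral>\<^sup>+x. ennreal \<alpha> * (ennreal (?g x) * indicator {0<..<1} x) \<partial>lborel)"
  proof (intro nn_integral_cong)
    fix x :: real
    show "ennreal (indicator {0<..<1} x * (x powr (1 - 1) * (1 - x) powr (\<alpha> - 1) / Beta 1 \<alpha>)) * ennreal ((1 - x) powr s) =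
       ennreal \<alpha> * (ennreal (?g x) * indicator {0<..<1} x)"
      using a by (auto simp: Beta_1_left powr_add[symmetric] algebra_simps simp flip: ennreal_mult split: split_indicator)
  qed
  also have "\<dots> = ennreal \<alpha> * (\<integral>\<^sup>+x. ennreal (?g x) * indicator {0<..<1} x \<partial>lborel)"
    by (intro nn_integral_cmult) measurable
  also have "(\<integral>\<^sup>+x. ennreal (?g x) * indicator {0<..<1} x \<partial>lborel) = ennreal (1 / (\<alpha> + s))"
    by (rule nn_integral_has_integral_lebesgue'[OF _ g]) auto
  also have "ennreal \<alpha> * ennreal (1 / (\<alpha> + s)) = ennreal (\<alpha> / (\<alpha> + s))"
    using a s by (simp flip: ennreal_mult)
  finally show ?thesis .
qed

lemma sets_beta_distribution[simp, measurable_cong]: "sets (beta_distribution a b) = sets borel"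
  by (simp add: beta_distribution_def)

lemma space_beta_distribution[simp]: "space (beta_distribution a b) = UNIV"
  by (simp add: beta_distribution_def)

lemma AE_beta_distribution: "AE x in beta_distribution a b. 0 < x \<and> x < 1"
  unfolding beta_distribution_def by (subst AE_density) (auto split: split_indicator)

lemma prob_space_beta_1:
  assumes "0 < \<alpha>" shows "prob_space (beta_distribution 1 \<alpha>)"
proof
  have "emeasure (beta_distribution 1 \<alpha>) (space (beta_distribution 1 \<alpha>)) = (\<integral>\<^sup>+x. 1 \<partial>beta_distribution 1 \<alpha>)"
    by simp
  also have "\<dots> = (\<integral>\<^sup>+x. ennreal ((1 - x) powr 0) \<partial>beta_distribution 1 \<alpha>)"
    by (intro nn_integral_cong_AE, use AE_beta_distribution[of 1 \<alpha>] in eventually_elim) auto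
  also have "\<dots> = 1" using nn_integral_beta_1_powr[of \<alpha> 0] assms by simp
  finally show "emeasure (beta_distribution 1 \<alpha>) (space (beta_distribution 1 \<alpha>)) = 1" .
qed

text \<open>
  The density \<open>\<alpha> * (1 - x) powr (\<alpha> - 1)\<close> does not increase, so its value at the right end bounds it from
  below on the interval.
\<close>

lemma measure_beta_1_interval_ge:
  assumes "1 \<le> \<alpha>" "0 \<le> a" "a \<le> b" "b < 1"
  shows "(b - a) * (1 - b) powr (\<alpha> - 1) \<le> measure (beta_distribution 1 \<alpha>) {a<..<b}"
proof -
  interpret prob_space "beta_distribution 1 \<alpha>" using assms by (intro prob_space_beta_1) auto
  have "ennreal ((b - a) * (1 - b) powr (\<alpha> - 1)) = (\<integral>\<^sup>+x. ennreal ((1 - b) powr (\<alpha> - 1)) * indicator {a<..<b} x \<partial>lborel)"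
    using assms by (subst nn_integral_cmult_indicator) (auto simp: ennreal_mult mult.commute)
  also have "\<dots> \<le> (\<integral>\<^sup>+x. ennreal (indicator {0<..<1} x * (x powr (1 - 1) * (1 - x) powr (\<alpha> - 1) / Beta 1 \<alpha>)) * indicator {a<..<b} x \<partial>lborel)"
  proof (intro nn_integral_mono)
    fix x :: real
    have "(1 - b) powr (\<alpha> - 1) \<le> \<alpha> * (1 - x) powr (\<alpha> - 1)" if "x \<in> {a<..<b}"
    proof -
      have "(1 - b) powr (\<alpha> - 1) \<le> (1 - x) powr (\<alpha> - 1)"
        using assms that by (intro powr_mono2) auto
      also have "\<dots> \<le> \<alpha> * (1 - x) powr (\<alpha> - 1)"
        using assms by (simp add: mult_le_cancel_right1)
      finally show ?thesis .
    qed
    then show "ennreal ((1 - b) powr (\<alpha> - 1)) * indicator {a<..<b} x \<le>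
      ennreal (indicator {0<..<1} x * (x powr (1 - 1) * (1 - x) powr (\<alpha> - 1) / Beta 1 \<alpha>)) * indicator {a<..<b} x"
      using assms by (auto simp: Beta_1_left mult.commute split: split_indicator intro!: ennreal_leI)
  qed
  also have "\<dots> = emeasure (beta_distribution 1 \<alpha>) {a<..<b}"
    unfolding beta_distribution_def by (subst emeasure_density) auto
  finally show ?thesis by (simp add: emeasure_eq_measure)
qed

section \<open>Translates of a kernel with log-gradient of polynomial growth\<close>

text \<open>
  \<open>ln f\<close> is Lipschitz on the ball of radius \<open>B\<close> around \<open>x\<close>, with the bound on the log-gradient at
  distance \<open>B + norm x\<close> from the origin as constant.
\<close>

lemma kernel_ratio_bound:
  fixes f :: "'a::euclidean_space \<Rightarrow> real"
  assumes diff: "f differentiable_on UNIV" and pos: "\<And>x. 0 < f x"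
    and D: "\<And>x. norm (Deriv (\<lambda>y. ln (f y)) x) \<le> R * (1 + norm x) powr \<gamma>"
    and R: "0 \<le> R" and g: "0 \<le> \<gamma>" and B: "norm \<theta> \<le> B" "norm \<theta>' \<le> B"
  shows "f (x - \<theta>) \<le> f (x - \<theta>') * exp (norm (\<theta> - \<theta>') * (R * (1 + B + norm x) powr \<gamma>))"
proof -
  let ?l = "\<lambda>y. ln (f y)"
  have ld: "?l differentiable (at y)" for y
  proof -
    have "f differentiable (at y)" using diff by (simp add: differentiable_on_def)
    then obtain f' where f': "(f has_derivative f') (at y)" by (auto simp: differentiable_def)
    have "((\<lambda>y. ln (f y)) has_derivative (\<lambda>h. inverse (f y) * f' h)) (at y)"
      using has_derivative_ln[OF pos f'] by (simp add: mult.commute divide_inverse)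
    then show ?thesis by (auto simp: differentiable_def)
  qed
  have "norm (?l (x - \<theta>) - ?l (x - \<theta>')) \<le> (R * (1 + B + norm x) powr \<gamma>) * norm ((x - \<theta>) - (x - \<theta>'))"
  proof (rule differentiable_bound)
    show "convex (cball x B)" by simp
    fix y assume y: "y \<in> cball x B"
    have fd: "(?l has_derivative frechet_derivative ?l (at y)) (at y)"
      using ld frechet_derivative_works by blast
    then show "(?l has_derivative frechet_derivative ?l (at y)) (at y within cball x B)"
      by (rule has_derivative_at_withinI)
    have "onorm (frechet_derivative ?l (at y)) = norm (Deriv ?l y)"
      unfolding Deriv_def using fd
      by (simp add: norm_blinfun.rep_eq bounded_linear_Blinfun_apply has_derivative_bounded_linear)
    also have "\<dots> \<le> R * (1 + norm y) powr \<gamma>" by (rule D)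
    also have "\<dots> \<le> R * (1 + B + norm x) powr \<gamma>"
    proof (intro mult_left_mono powr_mono2)
      have "norm y \<le> norm x + norm (x - y)" using norm_triangle_ineq2[of y x] by (simp add: norm_minus_commute)
      then show "1 + norm y \<le> 1 + B + norm x" using y by (simp add: dist_norm)
    qed (use R g in auto)
    finally show "onorm (frechet_derivative ?l (at y)) \<le> R * (1 + B + norm x) powr \<gamma>" .
  qed (use B in \<open>auto simp: dist_norm\<close>)
  then have "?l (x - \<theta>) \<le> ?l (x - \<theta>') + norm (\<theta> - \<theta>') * (R * (1 + B + norm x) powr \<gamma>)"
    by (simp add: norm_minus_commute mult.commute)
  then have "exp (?l (x - \<theta>)) \<le> exp (?l (x - \<theta>') + norm (\<theta> - \<theta>') * (R * (1 + B + norm x) powr \<gamma>))"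
    by simp
  then show ?thesis using pos by (simp add: exp_add)
qed

lemma growth_le:
  fixes t b \<gamma> :: real
  assumes "0 \<le> t" "1 \<le> b" "0 \<le> \<gamma>"
  shows "(b + t) powr \<gamma> \<le> 2 powr \<gamma> * b powr \<gamma> + 2 powr \<gamma> * t powr \<gamma>"
proof -
  have "(b + t) powr \<gamma> \<le> (2 * max b t) powr \<gamma>"
    using assms by (intro powr_mono2) auto
  also have "\<dots> = 2 powr \<gamma> * max b t powr \<gamma>" using assms by (subst powr_mult) auto
  also have "\<dots> \<le> 2 powr \<gamma> * (b powr \<gamma> + t powr \<gamma>)"
    by (intro mult_left_mono) (auto simp: max_def)
  finally show ?thesis by (simp add: distrib_left)
qed

text \<open>
  Passing from \<open>f x\<close> to \<open>f (x - \<theta>)\<close> costs an exponential of \<open>(1 + B + norm x) powr \<gamma>\<close>, which is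
  absorbed in the assumed exponential moments since \<open>(b + t) powr \<gamma>\<close> is at most a multiple of
  \<open>b powr \<gamma> + t powr \<gamma>\<close>.
\<close>

lemma exp_growth_moment_finite:
  fixes f :: "'a::euclidean_space \<Rightarrow> real"
  assumes [measurable]: "f \<in> borel_measurable borel" and pos: "\<And>x. 0 < f x"
    and ratio: "\<And>x \<theta>. norm \<theta> \<le> B \<Longrightarrow> f (x - \<theta>) \<le> f x * exp (B * (R * (1 + B + norm x) powr \<gamma>))"
    and int: "\<And>M. 0 < M \<Longrightarrow> integrable lborel (\<lambda>x. exp (M * norm x powr \<gamma>) * f x)"
    and R: "0 < R" and g: "0 \<le> \<gamma>" and B: "0 \<le> B" "norm \<theta> \<le> B" and M: "0 < M"
  shows "integrable lborel (\<lambda>x. exp (M * (1 + B + norm x) powr \<gamma>) * f (x - \<theta>))"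
proof -
  define c where "c = (M + B * R) * (2 powr \<gamma> * (1 + B) powr \<gamma>)"
  define M' where "M' = (M + B * R) * 2 powr \<gamma>"
  have MB: "M + B * R > 0" using R B M by (simp add: add_pos_nonneg)
  then have M': "M' > 0" unfolding M'_def by simp
  show ?thesis
  proof (rule Bochner_Integration.integrable_bound)
    show "integrable lborel (\<lambda>x. exp c * (exp (M' * norm x powr \<gamma>) * f x))"
      using int[OF M'] by simp
    show "AE x in lborel. norm (exp (M * (1 + B + norm x) powr \<gamma>) * f (x - \<theta>)) \<le> norm (exp c * (exp (M' * norm x powr \<gamma>) * f x))"
    proof (intro AE_I2)
      fix x
      have "exp (M * (1 + B + norm x) powr \<gamma>) * f (x - \<theta>) \<le>
         exp (M * (1 + B + norm x) powr \<gamma>) * (f x * exp (B * (R * (1 + B + norm x) powr \<gamma>)))"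
        by (intro mult_left_mono ratio B) auto
      also have "\<dots> = exp ((M + B * R) * (1 + B + norm x) powr \<gamma>) * f x"
        by (simp add: algebra_simps exp_add)
      also have "\<dots> \<le> exp (c + M' * norm x powr \<gamma>) * f x"
      proof (intro mult_right_mono iffD2[OF exp_le_cancel_iff])
        have "(M + B * R) * (1 + B + norm x) powr \<gamma> \<le> (M + B * R) * (2 powr \<gamma> * (1 + B) powr \<gamma> + 2 powr \<gamma> * norm x powr \<gamma>)"
          using MB B g by (intro mult_left_mono growth_le) auto
        then show "(M + B * R) * (1 + B + norm x) powr \<gamma> \<le> c + M' * norm x powr \<gamma>"
          unfolding c_def M'_def by (simp add: algebra_simps)
      qed (use pos in \<open>simp add: less_imp_le\<close>)
      finally show "norm (exp (M * (1 + B + norm x) powr \<gamma>) * f (x - \<theta>)) \<le> norm (exp c * (exp (M' * norm x powr \<gamma>) * f x))"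
        using pos by (simp add: exp_add abs_mult less_imp_le)
    qed
  qed measurable
qed

section \<open>Mixtures\<close>

text \<open>
  The truncation at \<open>0\<close> appears because \<open>ennreal\<close> sends negative weights to \<open>0\<close>.
\<close>

lemma mixture_atomic_measure:
  assumes [measurable]: "f \<in> borel_measurable borel"
  shows "mixture f (atomic_measure I w \<theta>) x = (\<integral>k. max 0 (w k) * f (x - \<theta> k) \<partial>count_space I)"
proof -
  have "density (count_space I) (\<lambda>k. ennreal (w k)) = density (count_space I) (\<lambda>k. ennreal (max 0 (w k)))"
    by (intro density_cong) (auto simp: max_def ennreal_neg)
  then have "mixture f (atomic_measure I w \<theta>) x =
      (\<integral>t. f (x - t) \<partial>distr (density (count_space I) (\<lambda>k. ennreal (max 0 (w k)))) borel \<theta>)"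
    by (simp add: mixture_def atomic_measure_def)
  also have "\<dots> = (\<integral>k. f (x - \<theta> k) \<partial>density (count_space I) (\<lambda>k. ennreal (max 0 (w k))))"
    by (rule integral_distr) auto
  also have "\<dots> = (\<integral>k. max 0 (w k) * f (x - \<theta> k) \<partial>count_space I)"
    by (subst integral_density) auto
  finally show ?thesis .
qed

lemma mixture_atomic_measure_finite:
  assumes "f \<in> borel_measurable borel" "finite I" "\<And>k. k \<in> I \<Longrightarrow> 0 \<le> w k"
  shows "mixture f (atomic_measure I w \<theta>) x = (\<Sum>k\<in>I. w k * f (x - \<theta> k))"
  using assms by (simp add: mixture_atomic_measure lebesgue_integral_count_space_finite)

lemma mixture_atomic_measure_sums:
  assumes "f \<in> borel_measurable borel" and f: "\<And>x. 0 \<le> f x" "\<And>x. f x \<le> F"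
    and w: "\<And>k. 0 \<le> w k" "summable w"
  shows "(\<lambda>k. w k * f (x - \<theta> k)) sums mixture f (atomic_measure UNIV w \<theta>) x"
proof -
  have "summable (\<lambda>k. w k * f (x - \<theta> k))"
    by (rule summable_comparison_test'[OF summable_mult2[OF w(2), of F], of 0])
      (use f w in \<open>auto intro!: mult_left_mono\<close>)
  then have "integrable (count_space UNIV) (\<lambda>k. w k * f (x - \<theta> k))"
    using f w by (simp add: integrable_count_space_nat_iff)
  from sums_integral_count_space_nat[OF this] show ?thesis
    using assms(1) w by (simp add: mixture_atomic_measure max_def)
qed

lemma mixture_nonneg: "(\<And>x. 0 \<le> f x) \<Longrightarrow> 0 \<le> mixture f P x"
  by (simp add: mixture_def)

text \<open>
  The mixture density is an integral over the index \<open>k\<close>, so joint measurability is that of a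
  parameter integral against the counting measure.
\<close>

lemma measurable_mixture_atomic_measure[measurable]:
  fixes f :: "'a::euclidean_space \<Rightarrow> real"
  assumes [measurable]: "f \<in> borel_measurable borel"
  shows "(\<lambda>((w, \<theta>), x). mixture f (atomic_measure UNIV w \<theta>) x) \<in>
     borel_measurable ((PiM UNIV (\<lambda>_. borel) \<Otimes>\<^sub>M PiM UNIV (\<lambda>_. borel)) \<Otimes>\<^sub>M borel)"
    (is "_ \<in> borel_measurable (?P \<Otimes>\<^sub>M borel)")
proof -
  interpret C: sigma_finite_measure "count_space (UNIV::nat set)"
    by (rule sigma_finite_measure_count_space)
  let ?g = "\<lambda>(z::((nat \<Rightarrow> real) \<times> (nat \<Rightarrow> 'a)) \<times> 'a, k). max 0 (fst (fst z) k) * f (snd z - snd (fst z) k)"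
  have "(\<lambda>z. ?g (snd z, fst z)) \<in> borel_measurable (count_space UNIV \<Otimes>\<^sub>M (?P \<Otimes>\<^sub>M borel))"
    by (rule measurable_pair_measure_countable1) simp_all
  from measurable_compose[OF measurable_pair_swap' this]
  have "?g \<in> borel_measurable ((?P \<Otimes>\<^sub>M borel) \<Otimes>\<^sub>M count_space UNIV)"
    by (simp add: split_beta')
  then have "(\<lambda>z. \<integral>k. ?g (z, k) \<partial>count_space UNIV) \<in> borel_measurable (?P \<Otimes>\<^sub>M borel)"
    by (intro C.borel_measurable_lebesgue_integral) (simp add: split_beta')
  then show ?thesis by (simp add: mixture_atomic_measure split_beta')
qed

section \<open>Likelihood ratios near the true mixture\<close>

lemma nn_integral_translate:
  fixes f :: "'a::euclidean_space \<Rightarrow> ennreal"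
  assumes [measurable]: "f \<in> borel_measurable borel"
  shows "(\<integral>\<^sup>+x. f (x - t) \<partial>lborel) = (\<integral>\<^sup>+x. f x \<partial>lborel)"
proof -
  have "(\<integral>\<^sup>+x. f x \<partial>lborel) = (\<integral>\<^sup>+x. f x \<partial>distr lborel borel ((+) (-t)))"
    by (simp add: lborel_distr_plus)
  also have "\<dots> = (\<integral>\<^sup>+x. f (x - t) \<partial>lborel)"
    by (subst nn_integral_distr) auto
  finally show ?thesis ..
qed

text \<open>
  The regularity of the kernel that the argument uses: a Harnack-type comparison of translates with
  factor \<open>exp (norm (\<theta> - \<theta>') * G x)\<close>, and finite exponential moments of \<open>G\<close>. In the
  application \<open>G x = R * (1 + B + norm x) powr \<gamma>\<close>, and \<open>B\<close> bounds the support of the atoms.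
\<close>

locale mixture_kernel =
  fixes f :: "'a::euclidean_space \<Rightarrow> real" and F B :: real and G :: "'a \<Rightarrow> real"
  assumes f_measurable[measurable]: "f \<in> borel_measurable borel"
    and f_pos: "0 < f x" and f_le: "f x \<le> F"
    and f_prob: "(\<integral>\<^sup>+x. ennreal (f x) \<partial>lborel) = 1"
    and G_measurable[measurable]: "G \<in> borel_measurable borel"
    and G_nonneg: "0 \<le> G x" and B_nonneg: "0 \<le> B"
    and kernel_ratio: "norm \<theta> \<le> B \<Longrightarrow> norm \<theta>' \<le> B \<Longrightarrow> f (x - \<theta>) \<le> f (x - \<theta>') * exp (norm (\<theta> - \<theta>') * G x)"
    and moments: "0 < M \<Longrightarrow> norm \<theta> \<le> B \<Longrightarrow> integrable lborel (\<lambda>x. exp (M * G x) * f (x - \<theta>))"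

locale finite_mixture_truth = mixture_kernel f F B G
  for f :: "'a::euclidean_space \<Rightarrow> real" and F B G +
  fixes K :: nat and wstar :: "nat \<Rightarrow> real" and \<theta>star :: "nat \<Rightarrow> 'a"
  assumes truth: "finite_mixing K wstar \<theta>star"
    and \<theta>star_le: "k < K \<Longrightarrow> norm (\<theta>star k) \<le> B"
begin

definition true_density :: "'a \<Rightarrow> real" where "true_density x = mixture f (atomic_measure {..<K} wstar \<theta>star) x"

abbreviation "Q \<equiv> density lborel (\<lambda>x. ennreal (true_density x))"

lemma wstar_pos: "k < K \<Longrightarrow> 0 < wstar k" and wstar_sum: "(\<Sum>k<K. wstar k) = 1"
  using truth by (auto simp: finite_mixing_def)

lemma K_pos: "0 < K"
  using wstar_sum by (cases K) auto

lemma true_density_eq: "true_density x = (\<Sum>k<K. wstar k * f (x - \<theta>star k))"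
  unfolding true_density_def by (intro mixture_atomic_measure_finite) (auto intro: less_imp_le wstar_pos)

lemma true_density_pos: "0 < true_density x"
  unfolding true_density_eq using K_pos by (intro sum_pos) (auto intro!: mult_pos_pos wstar_pos f_pos)

lemma true_density_measurable[measurable]: "true_density \<in> borel_measurable borel"
  unfolding true_density_eq[abs_def] by measurable

lemma ennreal_true_density: "ennreal (true_density x) = (\<Sum>k<K. ennreal (wstar k) * ennreal (f (x - \<theta>star k)))"
  unfolding true_density_eq by (subst sum_ennreal[symmetric])
    (auto simp: ennreal_mult less_imp_le wstar_pos f_pos)

lemma nn_integral_f_translate: "(\<integral>\<^sup>+x. ennreal (f (x - t)) \<partial>lborel) = 1"
  using nn_integral_translate[of "\<lambda>x. ennreal (f x)" t] by (simp add: f_prob)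

lemma prob_space_Q: "prob_space Q"
proof
  have "emeasure Q (space Q) = (\<integral>\<^sup>+x. (\<Sum>k<K. ennreal (wstar k) * ennreal (f (x - \<theta>star k))) \<partial>lborel)"
    by (subst emeasure_density) (auto simp: ennreal_true_density)
  also have "\<dots> = (\<Sum>k<K. ennreal (wstar k))"
    by (simp add: nn_integral_sum nn_integral_cmult nn_integral_f_translate)
  also have "\<dots> = 1"
    using wstar_sum by (subst sum_ennreal) (auto simp: less_imp_le wstar_pos)
  finally show "emeasure Q (space Q) = 1" .
qed

lemma integrable_exp_G: "0 < M \<Longrightarrow> integrable Q (\<lambda>x. exp (M * G x))"
proof -
  assume M: "0 < M"
  have "integrable lborel (\<lambda>x. \<Sum>k<K. wstar k * (exp (M * G x) * f (x - \<theta>star k)))"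
    by (intro Bochner_Integration.integrable_sum integrable_mult_right moments M) (auto simp: \<theta>star_le)
  then have "integrable lborel (\<lambda>x. true_density x * exp (M * G x))"
    by (simp add: true_density_eq sum_distrib_left sum_distrib_right mult_ac)
  then show ?thesis by (subst integrable_density) (auto simp: less_imp_le true_density_pos)
qed

text \<open>
  Any two atoms are at distance at most \<open>2 * B\<close>, so a single component and the true mixture dominate
  each other up to \<open>exp (2 * B * G x)\<close>.
\<close>

lemma f_le_true_density:
  assumes "norm \<theta> \<le> B" shows "f (x - \<theta>) \<le> true_density x * exp (2 * B * G x)"
    and "true_density x \<le> f (x - \<theta>) * exp (2 * B * G x)"
proof -
  have e: "exp (norm (t - t') * G x) \<le> exp (2 * B * G x)" if "norm t \<le> B" "norm t' \<le> B" for t t' :: 'a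
    using norm_triangle_ineq4[of t t'] that G_nonneg by (auto intro!: mult_right_mono)
  have *: "f (x - t) \<le> f (x - t') * exp (2 * B * G x)" if "norm t \<le> B" "norm t' \<le> B" for t t'
    using kernel_ratio[OF that] mult_left_mono[OF e[OF that] less_imp_le[OF f_pos[of "x - t'"]]] by (rule order_trans)
  have "f (x - \<theta>) = (\<Sum>k<K. wstar k * f (x - \<theta>))"
    by (simp add: sum_distrib_right[symmetric] wstar_sum)
  also have "\<dots> \<le> (\<Sum>k<K. wstar k * (f (x - \<theta>star k) * exp (2 * B * G x)))"
    by (intro sum_mono mult_left_mono *) (auto simp: assms \<theta>star_le less_imp_le wstar_pos)
  finally show "f (x - \<theta>) \<le> true_density x * exp (2 * B * G x)"
    by (simp add: true_density_eq sum_distrib_right mult.assoc)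
  have "true_density x \<le> (\<Sum>k<K. wstar k * (f (x - \<theta>) * exp (2 * B * G x)))"
    unfolding true_density_eq by (intro sum_mono mult_left_mono *) (auto simp: assms \<theta>star_le less_imp_le wstar_pos)
  then show "true_density x \<le> f (x - \<theta>) * exp (2 * B * G x)"
    by (simp add: sum_distrib_right[symmetric] wstar_sum)
qed

text \<open>
  First order in \<open>h\<close>: \<open>exp (h * G x) - 1 \<le> h * G x * exp (h * G x)\<close>, and \<open>h * G x\<close> and the
  exponential are absorbed in \<open>h * exp (2 * G x)\<close> as \<open>h \<le> 1\<close>.
\<close>

lemma component_diff_le:
  assumes "norm \<theta> \<le> B" "k < K" "norm (\<theta> - \<theta>star k) \<le> h" "0 \<le> h" "h \<le> 1"
  shows "\<bar>f (x - \<theta>) - f (x - \<theta>star k)\<bar> \<le> f (x - \<theta>star k) * (h * exp (2 * G x))"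
proof -
  have L: "h * G x \<ge> 0" using assms G_nonneg by simp
  have hG: "h * G x * exp (h * G x) \<le> h * exp (2 * G x)"
  proof -
    have "G x * exp (h * G x) \<le> exp (G x) * exp (G x)"
    proof (intro mult_mono)
      show "G x \<le> exp (G x)" using exp_ge_add_one_self[of "G x"] by linarith
      show "exp (h * G x) \<le> exp (G x)"
        using assms G_nonneg[of x] by (simp add: mult_left_le_one_le)
    qed (use G_nonneg in auto)
    then show ?thesis using assms by (simp add: exp_add[symmetric] mult.assoc mult_left_mono)
  qed
  have e: "exp (norm (\<theta> - \<theta>star k) * G x) \<le> exp (h * G x)"
    using assms G_nonneg by (auto intro!: mult_right_mono)
  have e1: "exp (h * G x) - 1 \<le> h * G x * exp (h * G x)"
    using exp_ge_add_one_self[of "- (h * G x)"] by (simp add: exp_minus field_simps)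
  have "f (x - \<theta>) \<le> f (x - \<theta>star k) * exp (h * G x)"
    using kernel_ratio[OF assms(1) \<theta>star_le[OF assms(2)], of x] mult_left_mono[OF e less_imp_le[OF f_pos[of "x - \<theta>star k"]]]
    by linarith
  then have "f (x - \<theta>) - f (x - \<theta>star k) \<le> f (x - \<theta>star k) * (exp (h * G x) - 1)"
    by (simp add: algebra_simps)
  also have "\<dots> \<le> f (x - \<theta>star k) * (h * exp (2 * G x))"
    using e1 hG f_pos[of "x - \<theta>star k"] by (intro mult_left_mono) auto
  finally have 1: "f (x - \<theta>) - f (x - \<theta>star k) \<le> f (x - \<theta>star k) * (h * exp (2 * G x))" .
  have "f (x - \<theta>star k) \<le> f (x - \<theta>) * exp (h * G x)"
    using kernel_ratio[OF \<theta>star_le[OF assms(2)] assms(1), of x] mult_left_mono[OF e less_imp_le[OF f_pos[of "x - \<theta>"]]]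
    by (simp add: norm_minus_commute)
  then have "f (x - \<theta>star k) * exp (- (h * G x)) \<le> f (x - \<theta>) * exp (h * G x) * exp (- (h * G x))"
    by (intro mult_right_mono) auto
  then have "f (x - \<theta>star k) * exp (- (h * G x)) \<le> f (x - \<theta>)"
    by (simp add: mult.assoc exp_add[symmetric])
  then have "f (x - \<theta>star k) - f (x - \<theta>) \<le> f (x - \<theta>star k) * (1 - exp (- (h * G x)))"
    by (simp add: algebra_simps)
  also have "\<dots> \<le> f (x - \<theta>star k) * (h * exp (2 * G x))"
  proof (intro mult_left_mono)
    have "1 - exp (- (h * G x)) \<le> h * G x" using exp_ge_add_one_self[of "- (h * G x)"] by simp
    also have "\<dots> \<le> h * G x * exp (h * G x)" using L by (simp add: mult_le_cancel_left1)
    also note hG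
    finally show "1 - exp (- (h * G x)) \<le> h * exp (2 * G x)" .
  qed (simp add: less_imp_le f_pos)
  finally show ?thesis using 1 by (simp add: abs_le_iff)
qed

text \<open>
  Moving each of the first \<open>K\<close> atoms by \<open>h\<close>, the weights by a total of order \<open>h\<close> and placing tail mass
  of order \<open>h\<close> anywhere in the ball changes the density by a relative amount of order \<open>h\<close>, with a
  factor that has all moments. The mass beyond the first \<open>K\<close> atoms is only of order \<open>h\<close> and not
  \<open>h\<^sup>2\<close>; this is why the likelihood ratio has to be expanded around \<open>1\<close> with the tail included.
\<close>

lemma mixture_ratio_bounds:
  fixes x :: 'a
  assumes w: "\<And>k. 0 \<le> w k" "w sums 1" and \<theta>: "\<And>k. norm (\<theta> k) \<le> B"
    and wd: "(\<Sum>k<K. \<bar>w k - wstar k\<bar>) + (1 - (\<Sum>k<K. w k)) \<le> c * h"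
    and \<theta>d: "\<And>k. k < K \<Longrightarrow> norm (\<theta> k - \<theta>star k) \<le> h" and h: "0 \<le> h" "h \<le> 1"
  defines "p \<equiv> mixture f (atomic_measure UNIV w \<theta>) x"
  shows "\<bar>p / true_density x - 1\<bar> \<le> h * ((c + 1) * exp ((2 * B + 2) * G x))"
    and "w 0 * exp (- (2 * B * G x)) \<le> p / true_density x"
proof -
  let ?E = "exp (2 * B * G x)"
  have sums: "(\<lambda>k. w k * f (x - \<theta> k)) sums p"
    unfolding p_def using w by (intro mixture_atomic_measure_sums[where F=F]) (auto simp: f_pos less_imp_le f_le sums_iff)
  have p0: "w 0 * f (x - \<theta> 0) \<le> p"
    using sum_le_suminf[of "\<lambda>k. w k * f (x - \<theta> k)" "{0}"] sums w by (auto simp: sums_iff f_pos less_imp_le)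
  have "w 0 * exp (- (2 * B * G x)) * true_density x \<le> w 0 * exp (- (2 * B * G x)) * (f (x - \<theta> 0) * ?E)"
    using w f_le_true_density(2)[OF \<theta>[of 0], of x] by (intro mult_left_mono) auto
  also have "\<dots> = w 0 * f (x - \<theta> 0)" by (simp add: exp_minus)
  also note p0
  finally show "w 0 * exp (- (2 * B * G x)) \<le> p / true_density x"
    using true_density_pos[of x] by (simp add: pos_le_divide_eq)
  have tail: "(\<lambda>i. w (i + K) * f (x - \<theta> (i + K))) sums (p - (\<Sum>k<K. w k * f (x - \<theta> k)))"
    using sums by (rule sums_split_initial_segment)
  have tw: "(\<lambda>i. w (i + K)) sums (1 - (\<Sum>k<K. w k))"
    using w(2) by (rule sums_split_initial_segment)
  have tail_le: "p - (\<Sum>k<K. w k * f (x - \<theta> k)) \<le> (1 - (\<Sum>k<K. w k)) * (true_density x * ?E)"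
    by (rule sums_le[OF _ tail sums_mult2[OF tw]]) (intro mult_left_mono f_le_true_density \<theta> w)
  have tail_ge: "0 \<le> p - (\<Sum>k<K. w k * f (x - \<theta> k))"
    by (rule sums_le[OF _ sums_zero tail]) (simp add: w less_imp_le f_pos)
  have head: "\<bar>(\<Sum>k<K. w k * f (x - \<theta> k)) - true_density x\<bar> \<le> (\<Sum>k<K. \<bar>w k - wstar k\<bar>) * (true_density x * ?E) + true_density x * (h * exp (2 * G x))"
  proof -
    have "(\<Sum>k<K. w k * f (x - \<theta> k)) - true_density x = (\<Sum>k<K. (w k - wstar k) * f (x - \<theta> k) + wstar k * (f (x - \<theta> k) - f (x - \<theta>star k)))"
      unfolding true_density_eq sum_subtractf[symmetric] by (intro sum.cong) (auto simp: algebra_simps)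
    also have "\<bar>\<dots>\<bar> \<le> (\<Sum>k<K. \<bar>w k - wstar k\<bar> * (true_density x * ?E) + wstar k * (f (x - \<theta>star k) * (h * exp (2 * G x))))"
    proof (rule order_trans[OF sum_abs], intro sum_mono)
      fix k assume k: "k \<in> {..<K}"
      have "\<bar>(w k - wstar k) * f (x - \<theta> k) + wstar k * (f (x - \<theta> k) - f (x - \<theta>star k))\<bar>
        \<le> \<bar>w k - wstar k\<bar> * f (x - \<theta> k) + wstar k * \<bar>f (x - \<theta> k) - f (x - \<theta>star k)\<bar>"
        using k by (intro order_trans[OF abs_triangle_ineq]) (auto simp: abs_mult less_imp_le wstar_pos f_pos)
      also have "\<dots> \<le> \<bar>w k - wstar k\<bar> * (true_density x * ?E) + wstar k * (f (x - \<theta>star k) * (h * exp (2 * G x)))"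
        using k by (intro add_mono mult_left_mono f_le_true_density component_diff_le \<theta> \<theta>d h) (auto simp: less_imp_le wstar_pos)
      finally show "\<bar>(w k - wstar k) * f (x - \<theta> k) + wstar k * (f (x - \<theta> k) - f (x - \<theta>star k))\<bar>
        \<le> \<bar>w k - wstar k\<bar> * (true_density x * ?E) + wstar k * (f (x - \<theta>star k) * (h * exp (2 * G x)))" .
    qed
    also have "\<dots> = (\<Sum>k<K. \<bar>w k - wstar k\<bar>) * (true_density x * ?E) + true_density x * (h * exp (2 * G x))"
      by (simp add: sum.distrib sum_distrib_right true_density_eq mult.assoc)
    finally show ?thesis .
  qed
  have "\<bar>p - true_density x\<bar> \<le> ((\<Sum>k<K. \<bar>w k - wstar k\<bar>) + (1 - (\<Sum>k<K. w k))) * (true_density x * ?E) + true_density x * (h * exp (2 * G x))"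
    using head tail_le tail_ge unfolding distrib_right by linarith
  also have "\<dots> \<le> (c * h) * (true_density x * ?E) + true_density x * (h * exp (2 * G x))"
    using true_density_pos[of x] by (intro add_mono mult_right_mono wd order_refl) auto
  also have "\<dots> \<le> (c * h) * (true_density x * exp ((2 * B + 2) * G x)) + true_density x * (h * exp ((2 * B + 2) * G x))"
  proof -
    have "0 \<le> (\<Sum>k<K. \<bar>w k - wstar k\<bar>) + (1 - (\<Sum>k<K. w k))"
      using sums_le[OF _ sums_zero tw] w by (auto intro!: add_nonneg_nonneg sum_nonneg)
    then have "0 \<le> c * h" using wd by linarith
    then show ?thesis using true_density_pos[of x] h G_nonneg[of x] B_nonneg
      by (intro add_mono mult_left_mono) (auto intro!: mult_right_mono)
  qed
  also have "\<dots> = true_density x * (h * ((c + 1) * exp ((2 * B + 2) * G x)))"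
    by (simp add: algebra_simps)
  finally have "\<bar>p - true_density x\<bar> / true_density x \<le> h * ((c + 1) * exp ((2 * B + 2) * G x))"
    using true_density_pos[of x] by (simp add: pos_divide_le_eq mult.commute)
  moreover have "\<bar>p / true_density x - 1\<bar> = \<bar>p - true_density x\<bar> / true_density x"
  proof -
    have "p / true_density x - 1 = (p - true_density x) / true_density x" using true_density_pos[of x] by (simp add: diff_divide_distrib)
    then show ?thesis using true_density_pos[of x] by (simp add: abs_divide)
  qed
  ultimately show "\<bar>p / true_density x - 1\<bar> \<le> h * ((c + 1) * exp ((2 * B + 2) * G x))" by simp
qed

lemma measurable_mixture_x[measurable]: "mixture f (atomic_measure UNIV w \<theta>) \<in> borel_measurable borel"
proof -
  have "(\<lambda>x. ((w, \<theta>), x)) \<in> measurable borel ((PiM UNIV (\<lambda>_. borel) \<Otimes>\<^sub>M PiM UNIV (\<lambda>_. borel)) \<Otimes>\<^sub>M borel)"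
    by (intro measurable_Pair measurable_const measurable_ident) (auto simp: space_pair_measure space_PiM)
  from measurable_compose[OF this measurable_mixture_atomic_measure[OF f_measurable]]
  show ?thesis by simp
qed

lemma nn_integral_mixture_ratio:
  assumes w: "\<And>k. 0 \<le> w k" "w sums 1"
  shows "(\<integral>\<^sup>+x. ennreal (mixture f (atomic_measure UNIV w \<theta>) x / true_density x) \<partial>Q) = 1"
proof -
  have sums: "(\<lambda>k. w k * f (x - \<theta> k)) sums mixture f (atomic_measure UNIV w \<theta>) x" for x
    using w by (intro mixture_atomic_measure_sums[where F=F]) (auto simp: f_pos less_imp_le f_le sums_iff)
  have "(\<integral>\<^sup>+x. ennreal (mixture f (atomic_measure UNIV w \<theta>) x / true_density x) \<partial>Q) =
     (\<integral>\<^sup>+x. ennreal (mixture f (atomic_measure UNIV w \<theta>) x) \<partial>lborel)"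
    using true_density_pos by (subst nn_integral_density)
      (auto intro!: nn_integral_cong simp: ennreal_mult'[symmetric] less_imp_le less_imp_neq[symmetric])
  also have "\<dots> = (\<integral>\<^sup>+x. (\<Sum>k. ennreal (w k) * ennreal (f (x - \<theta> k))) \<partial>lborel)"
  proof (intro nn_integral_cong)
    fix x
    show "ennreal (mixture f (atomic_measure UNIV w \<theta>) x) = (\<Sum>k. ennreal (w k) * ennreal (f (x - \<theta> k)))"
      using sums_unique[OF sums_ennreal[THEN iffD2, OF _ _ sums[of x]]] w f_pos
      by (simp add: ennreal_mult less_imp_le mixture_nonneg)
  qed
  also have "\<dots> = (\<Sum>k. ennreal (w k))"
    by (subst nn_integral_suminf) (auto simp: nn_integral_cmult nn_integral_f_translate)
  also have "\<dots> = 1"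
  proof -
    have "(\<lambda>k. ennreal (w k)) sums ennreal 1" using w by (subst sums_ennreal) auto
    then show ?thesis by (simp add: sums_iff)
  qed
  finally show ?thesis .
qed

definition inverse_ratio_const :: "real \<Rightarrow> real \<Rightarrow> real" where
  "inverse_ratio_const c w0 = (c + 1)\<^sup>2 / w0 * (\<integral>x. exp ((6 * B + 4) * G x) \<partial>Q)"

lemma inverse_ratio_const_nonneg: "0 < w0 \<Longrightarrow> 0 \<le> inverse_ratio_const c w0"
  by (simp add: inverse_ratio_const_def)

text \<open>
  With \<open>u = r - 1\<close> one has \<open>1 / r = 1 - u + u\<^sup>2 / r\<close>. The linear term has mean zero because both
  densities have mass \<open>1\<close>, and the last term is of order \<open>h\<^sup>2\<close> because \<open>u\<close> is of order \<open>h\<close> and \<open>1 / r\<close>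
  is controlled through the first component alone. With \<open>h\<^sup>2 = 1 / n\<close> the mean over \<open>n\<close> observations
  stays bounded.
\<close>

lemma nn_integral_inverse_ratio_le:
  assumes w: "\<And>k. 0 \<le> w k" "w sums 1" and \<theta>: "\<And>k. norm (\<theta> k) \<le> B"
    and wd: "(\<Sum>k<K. \<bar>w k - wstar k\<bar>) + (1 - (\<Sum>k<K. w k)) \<le> c * h"
    and \<theta>d: "\<And>k. k < K \<Longrightarrow> norm (\<theta> k - \<theta>star k) \<le> h" and h: "0 \<le> h" "h \<le> 1"
    and w0: "0 < w0" "w0 \<le> w 0"
  shows "(\<integral>\<^sup>+x. ennreal (1 / (mixture f (atomic_measure UNIV w \<theta>) x / true_density x)) \<partial>Q) \<le>
     ennreal (1 + inverse_ratio_const c w0 * h\<^sup>2)"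
proof -
  interpret Q: prob_space Q by (rule prob_space_Q)
  define r where "r x = mixture f (atomic_measure UNIV w \<theta>) x / true_density x" for x
  have [measurable]: "r \<in> borel_measurable borel" unfolding r_def by measurable
  have r0: "0 \<le> r x" for x unfolding r_def using true_density_pos[of x] by (simp add: mixture_nonneg less_imp_le f_pos)
  have r1: "(\<integral>\<^sup>+x. ennreal (r x) \<partial>Q) = 1"
    unfolding r_def using w by (rule nn_integral_mixture_ratio)
  have ri: "integrable Q r" by (rule integrableI_nonneg) (auto simp: r0 r1)
  have rI: "(\<integral>x. r x \<partial>Q) = 1" by (subst integral_eq_nn_integral) (auto simp: r0 r1)
  note b = mixture_ratio_bounds[OF w \<theta> wd \<theta>d h, folded r_def]
  let ?g = "\<lambda>x. exp ((6 * B + 4) * G x)"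
  have gi: "integrable Q ?g" using B_nonneg by (intro integrable_exp_G) simp
  have le: "1 / r x \<le> 2 - r x + h\<^sup>2 * ((c + 1)\<^sup>2 / w0) * ?g x" for x
  proof -
    have ir: "1 / r x \<le> exp (2 * B * G x) / w0" and rp: "0 < r x"
    proof -
      have "w0 * exp (- (2 * B * G x)) \<le> r x"
        by (rule order_trans[OF mult_right_mono[OF w0(2)] b(2)]) simp
      moreover have "0 < w0 * exp (- (2 * B * G x))" using w0 by simp
      ultimately show "0 < r x" by linarith
      have "1 / r x \<le> 1 / (w0 * exp (- (2 * B * G x)))"
        by (intro divide_left_mono) (use \<open>w0 * exp (- (2 * B * G x)) \<le> r x\<close> \<open>0 < w0 * exp (- (2 * B * G x))\<close> \<open>0 < r x\<close> in auto)
      then show "1 / r x \<le> exp (2 * B * G x) / w0" by (simp add: exp_minus field_simps)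
    qed
    have u: "(r x - 1)\<^sup>2 \<le> (h * ((c + 1) * exp ((2 * B + 2) * G x)))\<^sup>2"
      using power_mono[OF b(1)[of x], of 2] by simp
    have "1 / r x = 2 - r x + (r x - 1)\<^sup>2 * (1 / r x)"
      using rp by (simp add: field_simps power2_eq_square)
    also have "\<dots> \<le> 2 - r x + (h * ((c + 1) * exp ((2 * B + 2) * G x)))\<^sup>2 * (exp (2 * B * G x) / w0)"
      using u ir rp by (intro add_left_mono mult_mono) auto
    also have "\<dots> = 2 - r x + h\<^sup>2 * ((c + 1)\<^sup>2 / w0) * ?g x"
    proof -
      have "?g x = (exp ((2 * B + 2) * G x))\<^sup>2 * exp (2 * B * G x)"
        by (simp add: power2_eq_square exp_add[symmetric] algebra_simps)
      then show ?thesis by (simp add: power_mult_distrib mult_ac)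
    qed
    finally show ?thesis .
  qed
  have "(\<integral>\<^sup>+x. ennreal (1 / r x) \<partial>Q) \<le> (\<integral>\<^sup>+x. ennreal (2 - r x + h\<^sup>2 * ((c + 1)\<^sup>2 / w0) * ?g x) \<partial>Q)"
    by (intro nn_integral_mono ennreal_leI le)
  also have "\<dots> = ennreal (\<integral>x. 2 - r x + h\<^sup>2 * ((c + 1)\<^sup>2 / w0) * ?g x \<partial>Q)"
  proof (rule nn_integral_eq_integral)
    show "AE x in Q. 0 \<le> 2 - r x + h\<^sup>2 * ((c + 1)\<^sup>2 / w0) * ?g x"
    proof (intro AE_I2)
      fix x
      have "0 \<le> 1 / r x" using r0[of x] by simp
      with le[of x] show "0 \<le> 2 - r x + h\<^sup>2 * ((c + 1)\<^sup>2 / w0) * ?g x" by linarith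
    qed
    show "integrable Q (\<lambda>x. 2 - r x + h\<^sup>2 * ((c + 1)\<^sup>2 / w0) * ?g x)"
      by (intro Bochner_Integration.integrable_add Bochner_Integration.integrable_diff integrable_mult_right Q.integrable_const ri gi)
  qed
  also have "(\<integral>x. 2 - r x + h\<^sup>2 * ((c + 1)\<^sup>2 / w0) * ?g x \<partial>Q) = (\<integral>x. 2 \<partial>Q) - (\<integral>x. r x \<partial>Q) + (\<integral>x. h\<^sup>2 * ((c + 1)\<^sup>2 / w0) * ?g x \<partial>Q)"
    by (subst Bochner_Integration.integral_add, intro Bochner_Integration.integrable_diff Q.integrable_const ri, intro integrable_mult_right gi,
      subst Bochner_Integration.integral_diff[OF Q.integrable_const ri], rule refl)
  also have "\<dots> = 1 + inverse_ratio_const c w0 * h\<^sup>2"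
    unfolding inverse_ratio_const_def rI using Q.prob_space by (subst integral_mult_right_zero) (simp add: mult_ac)
  finally show ?thesis unfolding r_def .
qed

end

section \<open>Prior probabilities of sticks and atoms\<close>

lemma stick_remainder_moment:
  assumes a: "0 < \<alpha>" and s: "0 < \<alpha> + s"
  shows "(\<integral>\<^sup>+v. ennreal ((\<Prod>j<m. 1 - v j) powr s) \<partial>PiM (UNIV::nat set) (\<lambda>_. beta_distribution 1 \<alpha>)) =
     ennreal ((\<alpha> / (\<alpha> + s)) ^ m)"
proof -
  let ?b = "beta_distribution 1 \<alpha>"
  interpret b: prob_space ?b by (rule prob_space_beta_1[OF a])
  interpret P: product_prob_space "\<lambda>_::nat. ?b" UNIV by standard
  have AEv: "AE v in PiM (UNIV::nat set) (\<lambda>_. ?b). \<forall>j. 0 < v j \<and> v j < 1"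
    unfolding AE_all_countable by (intro allI P.AE_component AE_beta_distribution) simp
  have "(\<integral>\<^sup>+v. ennreal ((\<Prod>j<m. 1 - v j) powr s) \<partial>PiM (UNIV::nat set) (\<lambda>_. ?b)) =
     (\<integral>\<^sup>+v. (\<Prod>j<m. ennreal ((1 - v j) powr s)) \<partial>PiM (UNIV::nat set) (\<lambda>_. ?b))"
  proof (intro nn_integral_cong_AE, use AEv in eventually_elim)
    fix v :: "nat \<Rightarrow> real" assume v: "\<forall>j. 0 < v j \<and> v j < 1"
    then show "ennreal ((\<Prod>j<m. 1 - v j) powr s) = (\<Prod>j<m. ennreal ((1 - v j) powr s))"
      by (subst prod_ennreal) (auto simp: prod_powr_distrib less_imp_le)
  qed
  also have "\<dots> = (\<Prod>j<m. \<integral>\<^sup>+x. ennreal ((1 - x) powr s) \<partial>?b)"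
    using nn_integral_PiM_prod[OF b.prob_space_axioms, of m "\<lambda>_ x. ennreal ((1 - x) powr s)"] by simp
  also have "\<dots> = ennreal ((\<alpha> / (\<alpha> + s)) ^ m)"
    using a s by (simp add: nn_integral_beta_1_powr ennreal_power)
  finally show ?thesis .
qed

text \<open>
  The means of the remaining masses \<open>\<Prod>j<m. 1 - v j\<close> form a geometric series, so these masses are
  almost surely summable in \<open>m\<close>.
\<close>

lemma AE_sticks:
  assumes a: "0 < \<alpha>"
  shows "AE v in PiM (UNIV::nat set) (\<lambda>_. beta_distribution 1 \<alpha>).
     (\<forall>j. 0 < v j \<and> v j < 1) \<and> (\<lambda>m. \<Prod>j<m. 1 - v j) \<longlonglongrightarrow> 0"
proof -
  let ?b = "beta_distribution 1 \<alpha>"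
  let ?M = "PiM (UNIV::nat set) (\<lambda>_. ?b)"
  interpret b: prob_space ?b by (rule prob_space_beta_1[OF a])
  interpret P: product_prob_space "\<lambda>_::nat. ?b" UNIV by standard
  have AEv: "AE v in ?M. \<forall>j. 0 < v j \<and> v j < 1"
    unfolding AE_all_countable by (intro allI P.AE_component AE_beta_distribution) simp
  have m[measurable]: "(\<lambda>v. \<Prod>j<m. 1 - v j) \<in> borel_measurable ?M" for m :: nat
    by measurable
  have "(\<integral>\<^sup>+v. (\<Sum>m. ennreal ((\<Prod>j<m. 1 - v j) powr 1)) \<partial>?M) = (\<Sum>m. ennreal ((\<alpha> / (\<alpha> + 1)) ^ m))"
    using a by (subst nn_integral_suminf) (auto simp: stick_remainder_moment simp del: powr_one')
  also have "\<dots> = ennreal (\<Sum>m. (\<alpha> / (\<alpha> + 1)) ^ m)"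
    using a by (intro suminf_ennreal2 summable_geometric) auto
  finally have "(\<integral>\<^sup>+v. (\<Sum>m. ennreal ((\<Prod>j<m. 1 - v j) powr 1)) \<partial>?M) \<noteq> \<infinity>" by simp
  then have "AE v in ?M. (\<Sum>m. ennreal ((\<Prod>j<m. 1 - v j) powr 1)) \<noteq> \<infinity>"
    by (intro nn_integral_PInf_AE) measurable
  with AEv show ?thesis
  proof eventually_elim
    fix v :: "nat \<Rightarrow> real" assume v: "\<forall>j. 0 < v j \<and> v j < 1"
      and f: "(\<Sum>m. ennreal ((\<Prod>j<m. 1 - v j) powr 1)) \<noteq> \<infinity>"
    have nn: "0 \<le> (\<Prod>j<m. 1 - v j)" for m using v by (intro prod_nonneg) (auto simp: less_imp_le)
    have "summable (\<lambda>m. \<Prod>j<m. 1 - v j)"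
      using f nn by (intro summable_suminf_not_top) auto
    then show "(\<forall>j. 0 < v j \<and> v j < 1) \<and> (\<lambda>m. \<Prod>j<m. 1 - v j) \<longlonglongrightarrow> 0"
      using v by (auto intro: summable_LIMSEQ_zero)
  qed
qed

text \<open>
  Chernoff bound with the first moment of the remaining mass.
\<close>

lemma prob_stick_remainder_ge:
  assumes a: "0 < \<alpha>" and t: "0 < t"
  shows "measure (PiM (UNIV::nat set) (\<lambda>_. beta_distribution 1 \<alpha>))
     {v. t \<le> (\<Prod>j<m. 1 - v j)} \<le> (\<alpha> / (\<alpha> + 1)) ^ m / t"
proof -
  let ?b = "beta_distribution 1 \<alpha>"
  let ?M = "PiM (UNIV::nat set) (\<lambda>_. ?b)"
  interpret b: prob_space ?b by (rule prob_space_beta_1[OF a])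
  interpret P: product_prob_space "\<lambda>_::nat. ?b" UNIV by standard
  have s: "space ?M = UNIV" by (simp add: space_PiM)
  have [measurable]: "(\<lambda>v. \<Prod>j<m. 1 - v j) \<in> borel_measurable ?M" by measurable
  have "measure ?M {v \<in> space ?M. ennreal t \<le> ennreal ((\<Prod>j<m. 1 - v j) powr 1)} \<le> (\<alpha> / (\<alpha> + 1)) ^ m / t"
    using a t by (intro P.prob_Markov) (auto simp: stick_remainder_moment simp del: powr_one')
  moreover have "measure ?M {v. t \<le> (\<Prod>j<m. 1 - v j)} \<le> measure ?M {v \<in> space ?M. ennreal t \<le> ennreal ((\<Prod>j<m. 1 - v j) powr 1)}"
  proof (rule P.finite_measure_mono)
    show "{v. t \<le> (\<Prod>j<m. 1 - v j)} \<subseteq> {v \<in> space ?M. ennreal t \<le> ennreal ((\<Prod>j<m. 1 - v j) powr 1)}"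
      using t by (auto simp: s intro!: ennreal_leI)
  qed measurable
  ultimately show ?thesis by simp
qed

text \<open>
  Chernoff bound with the moment of order \<open>- s\<close>, which is finite only for \<open>s < \<alpha>\<close>. Taking \<open>s\<close> close to
  \<open>\<alpha>\<close> gives nearly the factor \<open>t powr \<alpha>\<close>.
\<close>

lemma prob_stick_remainder_le:
  assumes a: "0 < s" "s < \<alpha>" and t: "0 < t"
  shows "measure (PiM (UNIV::nat set) (\<lambda>_. beta_distribution 1 \<alpha>))
     {v. (\<Prod>j<m. 1 - v j) \<le> t} \<le> (\<alpha> / (\<alpha> - s)) ^ m * t powr s"
proof -
  let ?b = "beta_distribution 1 \<alpha>"
  let ?M = "PiM (UNIV::nat set) (\<lambda>_. ?b)"
  interpret b: prob_space ?b using a by (intro prob_space_beta_1) simp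
  interpret P: product_prob_space "\<lambda>_::nat. ?b" UNIV by standard
  have s: "space ?M = UNIV" by (simp add: space_PiM)
  have [measurable]: "(\<lambda>v. \<Prod>j<m. 1 - v j) \<in> borel_measurable ?M" by measurable
  have AEv: "AE v in ?M. \<forall>j. 0 < v j \<and> v j < 1"
    unfolding AE_all_countable by (intro allI P.AE_component AE_beta_distribution) simp
  have "measure ?M {v. (\<Prod>j<m. 1 - v j) \<le> t} \<le>
     measure ?M {v \<in> space ?M. ennreal (t powr (-s)) \<le> ennreal ((\<Prod>j<m. 1 - v j) powr (-s))}"
  proof (rule P.finite_measure_mono_AE)
    show "AE v in ?M. v \<in> {v. (\<Prod>j<m. 1 - v j) \<le> t} \<longrightarrow>
      v \<in> {v \<in> space ?M. ennreal (t powr (-s)) \<le> ennreal ((\<Prod>j<m. 1 - v j) powr (-s))}"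
      using AEv
    proof eventually_elim
      fix v :: "nat \<Rightarrow> real" assume v: "\<forall>j. 0 < v j \<and> v j < 1"
      then have "0 < (\<Prod>j<m. 1 - v j)" by (intro prod_pos) auto
      then show "v \<in> {v. (\<Prod>j<m. 1 - v j) \<le> t} \<longrightarrow>
        v \<in> {v \<in> space ?M. ennreal (t powr (-s)) \<le> ennreal ((\<Prod>j<m. 1 - v j) powr (-s))}"
        using a by (auto simp: s intro!: ennreal_leI powr_mono2')
    qed
  qed measurable
  also have "\<dots> \<le> (\<alpha> / (\<alpha> + - s)) ^ m / t powr (-s)"
    using a t by (intro P.prob_Markov) (auto simp: stick_remainder_moment)
  also have "\<dots> = (\<alpha> / (\<alpha> - s)) ^ m * t powr s"
    by (simp add: powr_minus field_simps)
  finally show ?thesis .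
qed

lemma measure_PiM_cylinder:
  assumes "prob_space M" and [measurable]: "\<And>k. k < K \<Longrightarrow> I k \<in> sets M"
  shows "measure (PiM (UNIV::nat set) (\<lambda>_. M)) {v \<in> space (PiM UNIV (\<lambda>_. M)). \<forall>k<K. v k \<in> I k} = (\<Prod>k<K. measure M (I k))"
proof -
  interpret M: prob_space M by fact
  interpret P: product_prob_space "\<lambda>_::nat. M" UNIV by standard
  let ?M = "PiM (UNIV::nat set) (\<lambda>_. M)"
  let ?S = "{v \<in> space ?M. \<forall>k<K. v k \<in> I k}"
  have S: "?S \<in> sets ?M" by measurable
  have "emeasure ?M ?S = (\<integral>\<^sup>+v. indicator ?S v \<partial>?M)" using S by simp
  also have "\<dots> = (\<integral>\<^sup>+v. (\<Prod>k<K. indicator (I k) (v k)) \<partial>?M)"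
    by (intro nn_integral_cong) (auto split: split_indicator simp: prod_zero_iff)
  also have "\<dots> = (\<Prod>k<K. emeasure M (I k))"
    by (subst nn_integral_PiM_prod) (auto intro: assms)
  also have "\<dots> = ennreal (\<Prod>k<K. measure M (I k))"
    by (simp add: M.emeasure_eq_measure prod_ennreal)
  finally show ?thesis by (simp add: P.emeasure_eq_measure prod_nonneg)
qed

text \<open>
  By continuity the density exceeds half of \<open>p0 t\<close> on \<open>\<Theta>\<close> near \<open>t\<close>, and \<open>\<Theta>\<close> fills a fixed fraction of
  small balls around \<open>t\<close>.
\<close>

lemma density_ball_mass_ge:
  fixes P0 :: "'a::euclidean_space measure"
  assumes P0: "prob_space P0" and dens: "has_continuous_bounded_density_on P0 p0 \<Theta>"
    and \<Theta>: "compact \<Theta>" and t: "t \<in> \<Theta>" "thick_at \<Theta> t" "0 < p0 t"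
  obtains c h0 where "0 < c" "0 < h0"
    "\<And>h. 0 < h \<Longrightarrow> h \<le> h0 \<Longrightarrow> c * h ^ DIM('a) \<le> measure P0 (cball t h)"
proof -
  interpret P0: prob_space P0 by fact
  from dens have cont: "continuous_on \<Theta> p0" and nn: "\<And>x. x \<in> \<Theta> \<Longrightarrow> 0 \<le> p0 x"
    and P0_eq: "P0 = density lborel (\<lambda>\<theta>. ennreal (indicator \<Theta> \<theta> * p0 \<theta>))"
    by (auto simp: has_continuous_bounded_density_on_def)
  have \<Theta>b[measurable]: "\<Theta> \<in> sets borel" using \<Theta> by (simp add: borel_compact)
  have [measurable]: "(\<lambda>x. indicator \<Theta> x * p0 x) \<in> borel_measurable borel"
    using borel_measurable_continuous_on_indicator[OF _ cont] by simp
  obtain d where d: "0 < d" "\<And>x. x \<in> \<Theta> \<Longrightarrow> dist x t < d \<Longrightarrow> dist (p0 x) (p0 t) < p0 t / 2"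
    using cont t unfolding continuous_on_iff by (metis half_gt_zero)
  obtain c0 e0 where c0: "0 < c0" "0 < e0"
    "\<And>e. 0 < e \<Longrightarrow> e \<le> e0 \<Longrightarrow> c0 * measure lborel (cball t e) \<le> measure lborel (\<Theta> \<inter> cball t e)"
    using t(2) unfolding thick_at_def by blast
  show thesis
  proof (rule that)
    show "0 < p0 t / 2 * (c0 * unit_ball_vol (DIM('a)))" using t c0 by simp
    show "0 < min e0 (d / 2)" using c0 d by simp
    fix h :: real assume h: "0 < h" "h \<le> min e0 (d / 2)"
    have "p0 t / 2 * (c0 * unit_ball_vol (DIM('a))) * h ^ DIM('a) = p0 t / 2 * (c0 * measure lborel (cball t h))"
      using h by (simp add: content_cball)
    also have "\<dots> \<le> p0 t / 2 * measure lborel (\<Theta> \<inter> cball t h)"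
      using c0(3)[of h] h t by (intro mult_left_mono) auto
    finally have 1: "p0 t / 2 * (c0 * unit_ball_vol (DIM('a))) * h ^ DIM('a) \<le> p0 t / 2 * measure lborel (\<Theta> \<inter> cball t h)" .
    have fin: "emeasure lborel (\<Theta> \<inter> cball t h) < \<infinity>"
      by (intro emeasure_bounded_finite bounded_subset[OF bounded_cball]) auto
    have "ennreal (p0 t / 2 * measure lborel (\<Theta> \<inter> cball t h)) = (\<integral>\<^sup>+x. ennreal (p0 t / 2) * indicator (\<Theta> \<inter> cball t h) x \<partial>lborel)"
      using t fin by (subst ennreal_mult) (auto simp: nn_integral_cmult_indicator emeasure_eq_ennreal_measure)
    also have "\<dots> \<le> (\<integral>\<^sup>+x. ennreal (indicator \<Theta> x * p0 x) * indicator (cball t h) x \<partial>lborel)"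
    proof (intro nn_integral_mono)
      fix x
      have "p0 t / 2 \<le> p0 x" if "x \<in> \<Theta>" "x \<in> cball t h"
      proof -
        have "dist x t < d" using that(2) h d(1) by (simp add: dist_commute)
        from d(2)[OF that(1) this] show ?thesis unfolding dist_real_def by linarith
      qed
      then show "ennreal (p0 t / 2) * indicator (\<Theta> \<inter> cball t h) x \<le> ennreal (indicator \<Theta> x * p0 x) * indicator (cball t h) x"
        by (auto split: split_indicator intro!: ennreal_leI)
    qed
    also have "\<dots> = emeasure P0 (cball t h)"
      unfolding P0_eq by (subst emeasure_density) auto
    finally have "p0 t / 2 * measure lborel (\<Theta> \<inter> cball t h) \<le> measure P0 (cball t h)"
      by (simp add: P0.emeasure_eq_measure)
    with 1 show "p0 t / 2 * (c0 * unit_ball_vol (DIM('a))) * h ^ DIM('a) \<le> measure P0 (cball t h)" by simp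
  qed
qed

section \<open>The Dirichlet process mixture\<close>

lemma AE_pair_fst:
  assumes "sigma_finite_measure M2" "AE x in M1. P x"
  shows "AE z in M1 \<Otimes>\<^sub>M M2. P (fst z)"
proof -
  interpret sigma_finite_measure M2 by fact
  obtain N where N: "{x \<in> space M1. \<not> P x} \<subseteq> N" "emeasure M1 N = 0" "N \<in> sets M1"
    using assms(2) by (rule AE_E)
  show ?thesis
  proof (rule AE_I[of _ _ "N \<times> space M2"])
    show "{z \<in> space (M1 \<Otimes>\<^sub>M M2). \<not> P (fst z)} \<subseteq> N \<times> space M2"
      using N(1) by (auto simp: space_pair_measure)
    show "emeasure (M1 \<Otimes>\<^sub>M M2) (N \<times> space M2) = 0"
      using N by (simp add: emeasure_pair_measure_Times)
  qed (use N in auto)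
qed

lemma AE_pair_snd:
  assumes "sigma_finite_measure M2" "AE x in M2. P x"
  shows "AE z in M1 \<Otimes>\<^sub>M M2. P (snd z)"
proof -
  interpret sigma_finite_measure M2 by fact
  obtain N where N: "{x \<in> space M2. \<not> P x} \<subseteq> N" "emeasure M2 N = 0" "N \<in> sets M2"
    using assms(2) by (rule AE_E)
  show ?thesis
  proof (rule AE_I[of _ _ "space M1 \<times> N"])
    show "{z \<in> space (M1 \<Otimes>\<^sub>M M2). \<not> P (snd z)} \<subseteq> space M1 \<times> N"
      using N(1) by (auto simp: space_pair_measure)
    show "emeasure (M1 \<Otimes>\<^sub>M M2) (space M1 \<times> N) = 0"
      using N by (simp add: emeasure_pair_measure_Times)
  qed (use N in auto)
qed

lemma measure_pair_Times:
  assumes "prob_space M1" "prob_space M2" "S1 \<in> sets M1" "S2 \<in> sets M2"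
  shows "measure (M1 \<Otimes>\<^sub>M M2) (S1 \<times> S2) = measure M1 S1 * measure M2 S2"
proof -
  interpret M1: prob_space M1 by fact
  interpret M2: prob_space M2 by fact
  show ?thesis using assms(3,4) by (simp add: measure_def M2.emeasure_pair_measure_Times enn2real_mult)
qed

lemma sets_PiM_cylinder:
  assumes [measurable]: "\<And>k. k < K \<Longrightarrow> I k \<in> sets M"
  shows "{v \<in> space (PiM (UNIV::nat set) (\<lambda>_. M)). \<forall>k<K. v k \<in> I k} \<in> sets (PiM UNIV (\<lambda>_. M))"
  by measurable

locale dp_mixture = finite_mixture_truth f F B G K wstar \<theta>star
  for f :: "'a::euclidean_space \<Rightarrow> real" and F B G K wstar \<theta>star +
  fixes \<alpha> :: real and P0 :: "'a measure" and p0 :: "'a \<Rightarrow> real" and \<Theta> :: "'a set"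
  assumes \<alpha>_ge_1: "1 \<le> \<alpha>" and P0_prob: "prob_space P0"
    and P0_dens: "has_continuous_bounded_density_on P0 p0 \<Theta>"
    and \<Theta>_compact: "compact \<Theta>" and \<Theta>_B: "\<Theta> \<subseteq> cball 0 B"
    and \<theta>star_in: "k < K \<Longrightarrow> \<theta>star k \<in> \<Theta>" and \<Theta>_thick: "k < K \<Longrightarrow> thick_at \<Theta> (\<theta>star k)"
    and p0_pos: "k < K \<Longrightarrow> 0 < p0 (\<theta>star k)"
begin

abbreviation "stick_law \<equiv> PiM (UNIV::nat set) (\<lambda>_. beta_distribution 1 \<alpha>)"
abbreviation "atom_law \<equiv> PiM (UNIV::nat set) (\<lambda>_. P0)"
abbreviation "\<Omega> \<equiv> stick_law \<Otimes>\<^sub>M atom_law"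

definition dp_density :: "(nat \<Rightarrow> real) \<times> (nat \<Rightarrow> 'a) \<Rightarrow> 'a \<Rightarrow> real" where
  "dp_density \<omega> x = mixture f (atomic_measure UNIV (stick_weights (fst \<omega>)) (snd \<omega>)) x"

lemma P0_eq: "P0 = density lborel (\<lambda>\<theta>. ennreal (indicator \<Theta> \<theta> * p0 \<theta>))"
  using P0_dens by (simp add: has_continuous_bounded_density_on_def)

lemma sets_P0[measurable_cong, simp]: "sets P0 = sets borel"
  by (subst P0_eq) simp

lemma space_P0[simp]: "space P0 = UNIV"
  by (subst P0_eq) simp

sublocale beta: prob_space "beta_distribution 1 \<alpha>"
  using \<alpha>_ge_1 by (intro prob_space_beta_1) simp
sublocale P0: prob_space P0 by (rule P0_prob)
sublocale sticks: prob_space stick_law by (intro prob_space_PiM) unfold_locales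
sublocale atoms: prob_space atom_law by (intro prob_space_PiM) unfold_locales
sublocale prior: pair_prob_space stick_law atom_law ..

lemma space_\<Omega>[simp]: "space \<Omega> = UNIV"
  by (simp add: space_pair_measure space_PiM)

lemma measurable_stick_map[measurable]:
  "(\<lambda>\<omega>. (stick_weights (fst \<omega>), snd \<omega>)) \<in> measurable \<Omega> (PiM UNIV (\<lambda>_. borel) \<Otimes>\<^sub>M PiM UNIV (\<lambda>_. borel))"
proof (rule measurable_Pair)
  show "(\<lambda>\<omega>. stick_weights (fst \<omega>)) \<in> measurable \<Omega> (PiM UNIV (\<lambda>_. borel))"
    unfolding stick_weights_def[abs_def] by (rule measurable_abs_UNIV) measurable
  show "snd \<in> measurable \<Omega> (PiM UNIV (\<lambda>_. borel))"
    using measurable_snd[of stick_law atom_law]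
    by (subst measurable_cong_sets[OF refl sets_PiM_cong[OF refl, of _ _ "\<lambda>_. P0"]]) simp_all
qed

lemma measurable_dp_density[measurable]: "(\<lambda>(\<omega>, x). dp_density \<omega> x) \<in> borel_measurable (\<Omega> \<Otimes>\<^sub>M borel)"
proof -
  have "(\<lambda>z. ((stick_weights (fst (fst z)), snd (fst z)), snd z)) \<in>
     measurable (\<Omega> \<Otimes>\<^sub>M borel) ((PiM UNIV (\<lambda>_. borel) \<Otimes>\<^sub>M PiM UNIV (\<lambda>_. borel)) \<Otimes>\<^sub>M borel)"
    by (intro measurable_Pair[OF measurable_compose[OF measurable_fst measurable_stick_map]] measurable_snd)
  from measurable_compose[OF this measurable_mixture_atomic_measure[OF f_measurable]]
  show ?thesis by (simp add: dp_density_def split_beta')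
qed

text \<open>
  The almost sure properties of the sticks and atoms on which the pathwise estimates rest.
\<close>

definition typical :: "(nat \<Rightarrow> real) \<times> (nat \<Rightarrow> 'a) \<Rightarrow> bool" where
  "typical \<omega> \<longleftrightarrow> (\<forall>j. 0 < fst \<omega> j \<and> fst \<omega> j < 1) \<and> (\<lambda>m. \<Prod>j<m. 1 - fst \<omega> j) \<longlonglongrightarrow> 0 \<and> (\<forall>j. norm (snd \<omega> j) \<le> B)"

lemma AE_typical: "AE \<omega> in \<Omega>. typical \<omega>"
proof -
  interpret A: product_prob_space "\<lambda>_::nat. P0" UNIV by standard
  have cont: "continuous_on \<Theta> p0"
    using P0_dens by (simp add: has_continuous_bounded_density_on_def)
  have [measurable]: "\<Theta> \<in> sets borel" using \<Theta>_compact by (simp add: borel_compact)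
  have [measurable]: "(\<lambda>x. indicator \<Theta> x * p0 x) \<in> borel_measurable borel"
    using borel_measurable_continuous_on_indicator[OF _ cont] by simp
  have "AE \<theta> in P0. norm \<theta> \<le> B"
    by (subst P0_eq, subst AE_density) (use \<Theta>_B in \<open>auto intro!: AE_I2 split: split_indicator\<close>)
  then have "AE \<theta> in atom_law. \<forall>j. norm (\<theta> j) \<le> B"
    unfolding AE_all_countable by (intro allI A.AE_component) simp_all
  from AE_pair_snd[OF atoms.sigma_finite_measure_axioms this]
    AE_pair_fst[OF atoms.sigma_finite_measure_axioms AE_sticks]
  show ?thesis using \<alpha>_ge_1 unfolding typical_def by simp
qed

lemma typical_weights:
  assumes "typical \<omega>"
  shows "0 \<le> stick_weights (fst \<omega>) k" and "stick_weights (fst \<omega>) sums 1"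
    and "weight_tail (stick_weights (fst \<omega>)) m = (\<Prod>j<m. 1 - fst \<omega> j)"
  using assms stick_weights_sums[of "fst \<omega>" 0]
  by (auto simp: typical_def less_imp_le intro!: stick_weights_nonneg weight_tail_stick_weights)

lemma dp_density_nonneg: "0 \<le> dp_density \<omega> x"
  by (simp add: dp_density_def mixture_nonneg less_imp_le f_pos)

lemma dp_density_le:
  assumes "typical \<omega>" shows "dp_density \<omega> x \<le> F"
proof -
  note w = typical_weights[OF assms]
  have "(\<lambda>k. stick_weights (fst \<omega>) k * f (x - snd \<omega> k)) sums dp_density \<omega> x"
    unfolding dp_density_def using w by (intro mixture_atomic_measure_sums[where F=F]) (auto simp: f_pos less_imp_le f_le sums_iff)
  from sums_le[OF _ this sums_mult2[OF w(2), of F]] show ?thesis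
    by (auto intro!: mult_left_mono w f_le)
qed

lemma nn_integral_dp_density_ratio: "typical \<omega> \<Longrightarrow> (\<integral>\<^sup>+x. ennreal (dp_density \<omega> x / true_density x) \<partial>Q) = 1"
  unfolding dp_density_def by (intro nn_integral_mixture_ratio typical_weights)

section \<open>Prior mass near the truth\<close>

text \<open>
  The set \<open>A\<close> puts the first \<open>K\<close> sticks and atoms within \<open>h\<close> of the truth. Each of the first \<open>K - 1\<close>
  sticks costs a factor of order \<open>h\<close>, each atom \<open>h ^ DIM('a)\<close>, and the \<open>K\<close>-th stick, which must use up
  all but a fraction \<open>h\<close> of the remaining mass, costs \<open>h powr \<alpha>\<close>. On \<open>A\<close> the total perturbation of
  the weights is at most \<open>(K * K + 1) * h\<close>.
\<close>

lemma prior_mass_and_inverse_ratio: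
  obtains c C h0 where "0 < c" "0 \<le> C" "0 < h0"
    "\<And>h. 0 < h \<Longrightarrow> h \<le> h0 \<Longrightarrow> \<exists>A\<in>sets \<Omega>.
       c * h powr (\<alpha> + real (K - 1) + real (DIM('a) * K)) \<le> measure \<Omega> A \<and>
       (AE \<omega> in \<Omega>. \<omega> \<in> A \<longrightarrow> (\<forall>x. 0 < dp_density \<omega> x / true_density x) \<and>
           (\<integral>\<^sup>+x. ennreal (1 / (dp_density \<omega> x / true_density x)) \<partial>Q) \<le> ennreal (1 + C * h\<^sup>2))"
proof -
  obtain u where u: "\<And>k. k < K \<Longrightarrow> stick_weights u k = wstar k" "\<And>k. k < K \<Longrightarrow> 0 < u k"
    "\<And>k. Suc k < K \<Longrightarrow> u k < 1" "\<And>k. Suc k = K \<Longrightarrow> u k = 1"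
    using stick_representation[of K wstar] wstar_pos wstar_sum by metis
  have u1: "u k \<le> 1" if "k < K" for k
    using u(3,4)[of k] that by (cases "Suc k = K") auto
  have "\<exists>c h0. 0 < c \<and> 0 < h0 \<and> (\<forall>h. 0 < h \<longrightarrow> h \<le> h0 \<longrightarrow> c * h ^ DIM('a) \<le> measure P0 (cball (\<theta>star k) h))"
    if "k < K" for k
    using density_ball_mass_ge[OF P0_prob P0_dens \<Theta>_compact \<theta>star_in[OF that] \<Theta>_thick[OF that] p0_pos[OF that]]
    by metis
  then obtain cb hb where cb: "\<And>k. k < K \<Longrightarrow> 0 < cb k" "\<And>k. k < K \<Longrightarrow> 0 < hb k"
    "\<And>k h. k < K \<Longrightarrow> 0 < h \<Longrightarrow> h \<le> hb k \<Longrightarrow> cb k * h ^ DIM('a) \<le> measure P0 (cball (\<theta>star k) h)"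
    by metis
  obtain K' where K': "K = Suc K'" using K_pos by (cases K) auto
  define h0 where "h0 = Min ({1, wstar 0 / 2} \<union> u ` {..<K} \<union> hb ` {..<K})"
  have h0: "0 < h0" unfolding h0_def
    using u(2) cb(2) wstar_pos[OF K_pos] by (subst Min_gr_iff) auto
  have h0_le: "h0 \<le> y" if "y \<in> {1, wstar 0 / 2} \<union> u ` {..<K} \<union> hb ` {..<K}" for y
    unfolding h0_def using that by (intro Min_le) auto
  define c where "c = ((\<Prod>k<K'. (1 - u k) powr (\<alpha> - 1)) * (1/2) powr \<alpha>) * (\<Prod>k<K. cb k)"
  define C where "C = inverse_ratio_const (real K * real K + 1) (wstar 0 / 2)"
  show thesis
  proof (rule that)
    show "0 < c" unfolding c_def using u(3) cb(1) K'
      by (intro mult_pos_pos prod_pos) (auto simp: less_imp_neq)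
    show "0 \<le> C" unfolding C_def using wstar_pos[OF K_pos] by (intro inverse_ratio_const_nonneg) auto
    show "0 < h0" by (rule h0)
    fix h :: real assume h: "0 < h" "h \<le> h0"
    have hk: "h \<le> u k" "h \<le> hb k" if "k < K" for k
      using h0_le[of "u k"] h0_le[of "hb k"] that h by auto
    have hh: "h \<le> 1" "h \<le> wstar 0 / 2" using h0_le[of 1] h0_le[of "wstar 0 / 2"] h by auto
    \<comment> \<open>The last true stick is \<open>1\<close>; the gap \<open>h / 2\<close> keeps the Beta density, which may vanish at \<open>1\<close>, of order \<open>h powr (\<alpha> - 1)\<close>.\<close>
    define I where "I k = (if Suc k < K then {u k - h<..<u k} else {1 - h<..<1 - h / 2})" for k
    have Iu: "\<bar>v - u k\<bar> \<le> h" if "v \<in> I k" "k < K" for v k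
      using that u(4)[of k] unfolding I_def by (auto split: if_splits)
    have Imass: "(\<Prod>k<K'. (1 - u k) powr (\<alpha> - 1)) * (1/2) powr \<alpha> * (h powr (\<alpha> + real (K - 1))) \<le> (\<Prod>k<K. measure (beta_distribution 1 \<alpha>) (I k))"
    proof -
      have "h * (1 - u k) powr (\<alpha> - 1) \<le> measure (beta_distribution 1 \<alpha>) (I k)" if "k < K'" for k
        using measure_beta_1_interval_ge[OF \<alpha>_ge_1, of "u k - h" "u k"] hk(1)[of k] u(3)[of k] that h
        by (simp add: I_def K')
      then have 1: "(\<Prod>k<K'. h * (1 - u k) powr (\<alpha> - 1)) \<le> (\<Prod>k<K'. measure (beta_distribution 1 \<alpha>) (I k))"
        using h by (intro prod_mono) auto
      have "(h / 2) * (h / 2) powr (\<alpha> - 1) \<le> measure (beta_distribution 1 \<alpha>) (I K')"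
        using measure_beta_1_interval_ge[OF \<alpha>_ge_1, of "1 - h" "1 - h / 2"] hh h
        by (simp add: I_def K')
      moreover have "(h / 2) * (h / 2) powr (\<alpha> - 1) = (1/2) powr \<alpha> * h powr \<alpha>"
      proof -
        have "(h / 2) * (h / 2) powr (\<alpha> - 1) = (h / 2) powr 1 * (h / 2) powr (\<alpha> - 1)"
          using powr_one[of "h / 2"] h by simp
        also have "\<dots> = (1/2 * h) powr \<alpha>" by (simp only: powr_add[symmetric]) simp
        also have "\<dots> = (1/2) powr \<alpha> * h powr \<alpha>" using h by (subst powr_mult) auto
        finally show ?thesis .
      qed
      ultimately have 2: "(1/2) powr \<alpha> * h powr \<alpha> \<le> measure (beta_distribution 1 \<alpha>) (I K')" by simp
      have "(\<Prod>k<K'. (1 - u k) powr (\<alpha> - 1)) * (1/2) powr \<alpha> * (h powr (\<alpha> + real (K - 1))) =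
        (\<Prod>k<K'. h * (1 - u k) powr (\<alpha> - 1)) * ((1/2) powr \<alpha> * h powr \<alpha>)"
        using h by (simp add: K' prod.distrib powr_add powr_realpow mult_ac)
      also have "\<dots> \<le> (\<Prod>k<K'. measure (beta_distribution 1 \<alpha>) (I k)) * measure (beta_distribution 1 \<alpha>) (I K')"
        by (intro mult_mono 1 2 prod_nonneg) auto
      finally show ?thesis by (simp add: K')
    qed
    have Bmass: "(\<Prod>k<K. cb k) * h powr (real (DIM('a) * K)) \<le> (\<Prod>k<K. measure P0 (cball (\<theta>star k) h))"
    proof -
      have "(\<Prod>k<K. cb k) * h powr (real (DIM('a) * K)) = (\<Prod>k<K. cb k * h ^ DIM('a))"
        unfolding powr_realpow[OF h(1)] by (simp add: prod.distrib power_mult)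
      also have "\<dots> \<le> (\<Prod>k<K. measure P0 (cball (\<theta>star k) h))"
        using cb hk h by (intro prod_mono) (auto intro!: mult_nonneg_nonneg less_imp_le)
      finally show ?thesis .
    qed
    define A1 where "A1 = {v \<in> space stick_law. \<forall>k<K. v k \<in> I k}"
    define A2 where "A2 = {\<theta> \<in> space atom_law. \<forall>k<K. \<theta> k \<in> cball (\<theta>star k) h}"
    have [measurable]: "I k \<in> sets borel" for k by (simp add: I_def)
    have A1: "A1 \<in> sets stick_law" unfolding A1_def by (rule sets_PiM_cylinder) simp
    have A2: "A2 \<in> sets atom_law" unfolding A2_def by (rule sets_PiM_cylinder) simp
    have mA: "measure \<Omega> (A1 \<times> A2) = (\<Prod>k<K. measure (beta_distribution 1 \<alpha>) (I k)) * (\<Prod>k<K. measure P0 (cball (\<theta>star k) h))"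
      unfolding measure_pair_Times[OF sticks.prob_space_axioms atoms.prob_space_axioms A1 A2]
    proof (rule arg_cong2[where f="(*)"])
      show "measure stick_law A1 = (\<Prod>k<K. measure (beta_distribution 1 \<alpha>) (I k))"
        unfolding A1_def by (rule measure_PiM_cylinder[OF beta.prob_space_axioms]) simp
      show "measure atom_law A2 = (\<Prod>k<K. measure P0 (cball (\<theta>star k) h))"
        unfolding A2_def by (rule measure_PiM_cylinder[OF P0_prob]) simp
    qed
    show "\<exists>A\<in>sets \<Omega>.
       c * h powr (\<alpha> + real (K - 1) + real (DIM('a) * K)) \<le> measure \<Omega> A \<and>
       (AE \<omega> in \<Omega>. \<omega> \<in> A \<longrightarrow> (\<forall>x. 0 < dp_density \<omega> x / true_density x) \<and>
           (\<integral>\<^sup>+x. ennreal (1 / (dp_density \<omega> x / true_density x)) \<partial>Q) \<le> ennreal (1 + C * h\<^sup>2))"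
    proof (intro bexI[of _ "A1 \<times> A2"] conjI)
      show "A1 \<times> A2 \<in> sets \<Omega>" using A1 A2 by simp
      have "c * h powr (\<alpha> + real (K - 1) + real (DIM('a) * K)) =
        ((\<Prod>k<K'. (1 - u k) powr (\<alpha> - 1)) * (1/2) powr \<alpha> * (h powr (\<alpha> + real (K - 1)))) * ((\<Prod>k<K. cb k) * h powr (real (DIM('a) * K)))"
        unfolding c_def powr_add by (simp only: mult_ac)
      also have "\<dots> \<le> measure \<Omega> (A1 \<times> A2)"
        unfolding mA using cb(1) by (intro mult_mono Imass Bmass prod_nonneg mult_nonneg_nonneg) (auto intro: less_imp_le)
      finally show "c * h powr (\<alpha> + real (K - 1) + real (DIM('a) * K)) \<le> measure \<Omega> (A1 \<times> A2)" .
      show "AE \<omega> in \<Omega>. \<omega> \<in> A1 \<times> A2 \<longrightarrow> (\<forall>x. 0 < dp_density \<omega> x / true_density x) \<and>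
           (\<integral>\<^sup>+x. ennreal (1 / (dp_density \<omega> x / true_density x)) \<partial>Q) \<le> ennreal (1 + C * h\<^sup>2)"
        using AE_typical
      proof (eventually_elim, intro impI)
        fix \<omega> assume tp: "typical \<omega>" and \<omega>: "\<omega> \<in> A1 \<times> A2"
        let ?v = "fst \<omega>" and ?w = "stick_weights (fst \<omega>)"
        have vI: "?v k \<in> I k" if "k < K" for k using \<omega> that by (auto simp: A1_def)
        have v01: "0 < ?v j" "?v j < 1" for j using tp by (auto simp: typical_def)
        note w = typical_weights[OF tp]
        have w_diff: "\<bar>?w k - wstar k\<bar> \<le> (real k + 1) * h" if k: "k < K" for k
        proof -
          have "\<bar>?w k - stick_weights u k\<bar> \<le> (real k + 1) * h"
          proof (rule stick_weights_diff_le)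
            fix j assume "j \<le> k"
            with k have j: "j < K" by simp
            show "\<bar>?v j\<bar> \<le> 1 \<and> \<bar>1 - ?v j\<bar> \<le> 1" using v01[of j] by simp
            show "\<bar>u j\<bar> \<le> 1 \<and> \<bar>1 - u j\<bar> \<le> 1" using u(2)[OF j] u1[OF j] by simp
            show "\<bar>?v j - u j\<bar> \<le> h" by (intro Iu vI j)
          qed
          then show ?thesis using u(1)[OF k] by simp
        qed
        have "(\<Sum>k<K. \<bar>?w k - wstar k\<bar>) \<le> (\<Sum>k<K. real K * h)"
        proof (intro sum_mono)
          fix k assume k: "k \<in> {..<K}"
          have "(real k + 1) * h \<le> real K * h" using k h by (intro mult_right_mono) auto
          with w_diff[of k] k show "\<bar>?w k - wstar k\<bar> \<le> real K * h" by simp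
        qed
        then have S1: "(\<Sum>k<K. \<bar>?w k - wstar k\<bar>) \<le> real K * real K * h" by simp
        have S2: "1 - (\<Sum>k<K. ?w k) \<le> h"
        proof -
          have "1 - (\<Sum>k<K. ?w k) = (\<Prod>j<K. 1 - ?v j)"
            using sum_stick_weights[where v="?v" and m=0 and N=K] by simp
          also have "\<dots> = (\<Prod>j<K'. 1 - ?v j) * (1 - ?v K')" by (simp add: K')
          also have "\<dots> \<le> 1 * (1 - ?v K')"
            using v01 by (intro mult_right_mono prod_le_1) (auto simp: less_imp_le)
          also have "\<dots> \<le> h" using vI[of K'] h by (simp add: I_def K')
          finally show ?thesis .
        qed
        have bound: "(\<Sum>k<K. \<bar>?w k - wstar k\<bar>) + (1 - (\<Sum>k<K. ?w k)) \<le> (real K * real K + 1) * h"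
          using S1 S2 by (simp add: distrib_right)
        have \<theta>1: "norm (snd \<omega> k) \<le> B" for k using tp by (simp add: typical_def)
        have \<theta>2: "norm (snd \<omega> k - \<theta>star k) \<le> h" if "k < K" for k
          using \<omega> that by (auto simp: A2_def dist_norm norm_minus_commute)
        have w0: "wstar 0 / 2 \<le> ?w 0" using w_diff[OF K_pos] hh by (simp add: abs_le_iff)
        have w0p: "0 < wstar 0 / 2" using wstar_pos[OF K_pos] by simp
        note b = mixture_ratio_bounds(2)[OF w(1,2) \<theta>1 bound \<theta>2 less_imp_le[OF h(1)] hh(1)]
        show "(\<forall>x. 0 < dp_density \<omega> x / true_density x) \<and>
           (\<integral>\<^sup>+x. ennreal (1 / (dp_density \<omega> x / true_density x)) \<partial>Q) \<le> ennreal (1 + C * h\<^sup>2)"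
        proof (intro conjI allI)
          fix x
          have "0 < ?w 0 * exp (- (2 * B * G x))" using w0 w0p by simp
          also have "\<dots> \<le> dp_density \<omega> x / true_density x" unfolding dp_density_def by (rule b)
          finally show "0 < dp_density \<omega> x / true_density x" .
        next
          show "(\<integral>\<^sup>+x. ennreal (1 / (dp_density \<omega> x / true_density x)) \<partial>Q) \<le> ennreal (1 + C * h\<^sup>2)"
            unfolding dp_density_def C_def
            by (rule nn_integral_inverse_ratio_le[OF w(1,2) \<theta>1 bound \<theta>2 less_imp_le[OF h(1)] hh(1) w0p w0])
        qed
      qed
    qed
  qed
qed

end

section \<open>Tail weights under prior and posterior\<close>

lemma power_nat_ceiling_le:
  assumes "1 \<le> \<rho>" "0 \<le> \<beta>" "1 \<le> (x::real)"
  shows "\<rho> ^ nat \<lceil>\<beta> * ln x\<rceil> \<le> \<rho> * x powr (\<beta> * ln \<rho>)"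
proof -
  have "0 \<le> \<beta> * ln x" using assms by simp
  then have m: "real (nat \<lceil>\<beta> * ln x\<rceil>) \<le> \<beta> * ln x + 1" by linarith
  have "\<rho> ^ nat \<lceil>\<beta> * ln x\<rceil> = exp (real (nat \<lceil>\<beta> * ln x\<rceil>) * ln \<rho>)"
    by (subst exp_of_nat_mult) (use assms in simp)
  also have "\<dots> \<le> exp ((\<beta> * ln x + 1) * ln \<rho>)"
    using m assms by (intro iffD2[OF exp_le_cancel_iff] mult_right_mono) auto
  also have "\<dots> = \<rho> * x powr (\<beta> * ln \<rho>)"
    using assms by (simp add: powr_def exp_add algebra_simps)
  finally show ?thesis .
qed

lemma power_nat_ceiling_ge:
  assumes "0 < \<rho>" "\<rho> \<le> 1" "0 \<le> \<beta>" "1 \<le> (x::real)"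
  shows "\<rho> ^ nat \<lceil>\<beta> * ln x\<rceil> \<le> x powr (\<beta> * ln \<rho>)"
proof -
  have m: "\<beta> * ln x \<le> real (nat \<lceil>\<beta> * ln x\<rceil>)" by linarith
  have "\<rho> ^ nat \<lceil>\<beta> * ln x\<rceil> = exp (real (nat \<lceil>\<beta> * ln x\<rceil>) * ln \<rho>)"
    by (subst exp_of_nat_mult) (use assms in simp)
  also have "\<dots> \<le> exp ((\<beta> * ln x) * ln \<rho>)"
    using m assms by (intro iffD2[OF exp_le_cancel_iff] mult_right_mono_neg) auto
  also have "\<dots> = x powr (\<beta> * ln \<rho>)"
    using assms by (simp add: powr_def algebra_simps)
  finally show ?thesis .
qed

lemma measurable_weight_tail[measurable]:
  "(\<lambda>w. weight_tail w m) \<in> borel_measurable (PiM UNIV (\<lambda>_. borel))"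
  unfolding weight_tail_def by measurable

context dp_mixture
begin

definition bad_tail :: "real \<Rightarrow> nat \<Rightarrow> nat \<Rightarrow> ((nat \<Rightarrow> real) \<times> (nat \<Rightarrow> 'a)) set" where
  "bad_tail t m1 m2 = {\<omega>. \<not> (t < weight_tail (stick_weights (fst \<omega>)) m1 \<and> weight_tail (stick_weights (fst \<omega>)) m2 < t)}"

lemma measurable_stick_tail[measurable]: "(\<lambda>\<omega>. weight_tail (stick_weights (fst \<omega>)) m) \<in> borel_measurable \<Omega>"
proof -
  have "(\<lambda>\<omega>. stick_weights (fst \<omega>)) \<in> measurable \<Omega> (PiM UNIV (\<lambda>_. borel))"
    using measurable_compose[OF measurable_stick_map measurable_fst] by simp
  from measurable_compose[OF this measurable_weight_tail] show ?thesis .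
qed

lemma bad_tail_sets[measurable]: "bad_tail t m1 m2 \<in> sets \<Omega>"
proof -
  have "{\<omega> \<in> space \<Omega>. \<not> (t < weight_tail (stick_weights (fst \<omega>)) m1 \<and> weight_tail (stick_weights (fst \<omega>)) m2 < t)} \<in> sets \<Omega>"
    by measurable
  then show ?thesis unfolding bad_tail_def by simp
qed

text \<open>
  Almost surely the tail weight after \<open>m\<close> sticks is the remaining mass, so the two ways to fail are
  the two Chernoff events.
\<close>

lemma prob_bad_tail_le:
  assumes s: "0 < s" "s < \<alpha>" and t: "0 < t"
  shows "measure \<Omega> (bad_tail t m1 m2) \<le> (\<alpha> / (\<alpha> - s)) ^ m1 * t powr s + (\<alpha> / (\<alpha> + 1)) ^ m2 / t"
proof -
  define S1 where "S1 = {v. (\<Prod>j<m1. 1 - v j) \<le> t}"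
  define S2 where "S2 = {v. t \<le> (\<Prod>j<m2. 1 - v j)}"
  have sp: "space stick_law = UNIV" by (simp add: space_PiM)
  have [measurable]: "(\<lambda>v. \<Prod>j<m. 1 - v j) \<in> borel_measurable stick_law" for m by measurable
  have "{v \<in> space stick_law. (\<Prod>j<m1. 1 - v j) \<le> t} \<in> sets stick_law" by measurable
  then have S1: "S1 \<in> sets stick_law" by (simp add: S1_def sp)
  have "{v \<in> space stick_law. t \<le> (\<Prod>j<m2. 1 - v j)} \<in> sets stick_law" by measurable
  then have S2: "S2 \<in> sets stick_law" by (simp add: S2_def sp)
  have m: "measure \<Omega> (S \<times> space atom_law) = measure stick_law S" if "S \<in> sets stick_law" for S
    using measure_pair_Times[OF sticks.prob_space_axioms atoms.prob_space_axioms that sets.top]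
    by (simp add: atoms.prob_space)
  have "measure \<Omega> (bad_tail t m1 m2) \<le> measure \<Omega> (S1 \<times> space atom_law \<union> S2 \<times> space atom_law)"
  proof (rule prior.finite_measure_mono_AE)
    show "AE \<omega> in \<Omega>. \<omega> \<in> bad_tail t m1 m2 \<longrightarrow> \<omega> \<in> S1 \<times> space atom_law \<union> S2 \<times> space atom_law"
      using AE_typical
    proof eventually_elim
      fix \<omega> assume tp: "typical \<omega>"
      obtain v \<theta> where \<omega>: "\<omega> = (v, \<theta>)" by (cases \<omega>)
      have "weight_tail (stick_weights v) m = (\<Prod>j<m. 1 - v j)" for m
        using typical_weights(3)[OF tp] by (simp add: \<omega>)
      then show "\<omega> \<in> bad_tail t m1 m2 \<longrightarrow> \<omega> \<in> S1 \<times> space atom_law \<union> S2 \<times> space atom_law"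
        by (auto simp: \<omega> bad_tail_def S1_def S2_def space_PiM)
    qed
    show "S1 \<times> space atom_law \<union> S2 \<times> space atom_law \<in> sets \<Omega>" using S1 S2 by auto
  qed
  also have "\<dots> \<le> measure \<Omega> (S1 \<times> space atom_law) + measure \<Omega> (S2 \<times> space atom_law)"
    using S1 S2 by (intro measure_Un_le) auto
  also have "\<dots> = measure stick_law S1 + measure stick_law S2" using S1 S2 by (simp add: m)
  also have "\<dots> \<le> (\<alpha> / (\<alpha> - s)) ^ m1 * t powr s + (\<alpha> / (\<alpha> + 1)) ^ m2 / t"
    unfolding S1_def S2_def using s t by (intro add_mono prob_stick_remainder_le prob_stick_remainder_ge) auto
  finally show ?thesis .
qed

abbreviation "tail_event t m1 m2 \<equiv> {(w :: nat \<Rightarrow> real, \<theta> :: nat \<Rightarrow> 'a). weight_tail w m1 > t \<and> weight_tail w m2 < t}"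

lemma likelihood_stick_map: "likelihood f X n (stick_weights (fst \<omega>), snd \<omega>) = (\<Prod>i<n. dp_density \<omega> (X i))"
  by (simp add: likelihood_def dp_density_def)

text \<open>
  The posterior of the tail event, pulled back to the independent sticks and atoms.
\<close>

lemma posterior_tail_event:
  "posterior (DP_prior \<alpha> P0) f n X (tail_event t m1 m2) =
    (\<integral>\<omega>. indicator (- bad_tail t m1 m2) \<omega> * (\<Prod>i<n. dp_density \<omega> (X i)) \<partial>\<Omega>) / (\<integral>\<omega>. (\<Prod>i<n. dp_density \<omega> (X i)) \<partial>\<Omega>)"
proof -
  let ?P = "PiM (UNIV::nat set) (\<lambda>_. borel :: real measure) \<Otimes>\<^sub>M PiM (UNIV::nat set) (\<lambda>_. borel :: 'a measure)"
  let ?T = "\<lambda>\<omega>. (stick_weights (fst \<omega>), snd \<omega> :: nat \<Rightarrow> 'a)"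
  have DP: "DP_prior \<alpha> P0 = distr \<Omega> ?P ?T" by (simp add: DP_prior_def split_beta')
  have [measurable]: "(\<lambda>p. mixture f (atomic_measure UNIV (fst p) (snd p)) x) \<in> borel_measurable ?P" for x
  proof -
    have "(\<lambda>p. (p, x)) \<in> measurable ?P (?P \<Otimes>\<^sub>M borel)" by measurable
    from measurable_compose[OF this measurable_mixture_atomic_measure[OF f_measurable]]
    show ?thesis by (simp add: split_beta')
  qed
  have L[measurable]: "likelihood f X n \<in> borel_measurable ?P"
    unfolding likelihood_def split_beta' by measurable
  have "{p \<in> space ?P. weight_tail (fst p) m1 > t \<and> weight_tail (fst p) m2 < t} \<in> sets ?P"
    by measurable
  then have S[measurable]: "tail_event t m1 m2 \<in> sets ?P"
    by (simp add: split_beta' space_pair_measure space_PiM)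
  have ind: "indicator (tail_event t m1 m2) (?T \<omega>) = (indicator (- bad_tail t m1 m2) \<omega> :: real)" for \<omega>
    by (auto simp: bad_tail_def split: split_indicator)
  have "integral\<^sup>L (DP_prior \<alpha> P0) (likelihood f X n) = (\<integral>\<omega>. (\<Prod>i<n. dp_density \<omega> (X i)) \<partial>\<Omega>)"
    unfolding DP by (subst integral_distr[OF measurable_stick_map L]) (simp add: likelihood_stick_map)
  moreover have "set_lebesgue_integral (DP_prior \<alpha> P0) (tail_event t m1 m2) (likelihood f X n) =
      (\<integral>\<omega>. indicator (- bad_tail t m1 m2) \<omega> * (\<Prod>i<n. dp_density \<omega> (X i)) \<partial>\<Omega>)"
  proof -
    have "(\<lambda>p. indicator (tail_event t m1 m2) p *\<^sub>R likelihood f X n p) \<in> borel_measurable ?P"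
      by measurable
    from integral_distr[OF measurable_stick_map this] show ?thesis
      unfolding DP set_lebesgue_integral_def by (simp only: likelihood_stick_map ind real_scaleR_def)
  qed
  ultimately show ?thesis by (simp add: posterior_def)
qed

lemma measurable_dp_density_data[measurable]:
  "(\<lambda>(X, \<omega>). dp_density \<omega> (X i)) \<in> borel_measurable (PiM (UNIV::nat set) (\<lambda>_. Q) \<Otimes>\<^sub>M \<Omega>)"
proof -
  have "(\<lambda>z. (snd z, fst z i)) \<in> measurable (PiM (UNIV::nat set) (\<lambda>_. Q) \<Otimes>\<^sub>M \<Omega>) (\<Omega> \<Otimes>\<^sub>M borel)"
    by measurable
  from measurable_compose[OF this measurable_dp_density] show ?thesis by (simp add: split_beta')
qed

lemma measurable_posterior:
  "(\<lambda>X. posterior (DP_prior \<alpha> P0) f n X (tail_event t m1 m2)) \<in> borel_measurable (PiM (UNIV::nat set) (\<lambda>_. Q))"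
  unfolding posterior_tail_event
proof (intro borel_measurable_divide prior.borel_measurable_lebesgue_integral)
  show "(\<lambda>(X, \<omega>). \<Prod>i<n. dp_density \<omega> (X i)) \<in> borel_measurable (PiM (UNIV::nat set) (\<lambda>_. Q) \<Otimes>\<^sub>M \<Omega>)"
    by measurable
  show "(\<lambda>(X, \<omega>). indicator (- bad_tail t m1 m2) \<omega> * (\<Prod>i<n. dp_density \<omega> (X i))) \<in> borel_measurable (PiM (UNIV::nat set) (\<lambda>_. Q) \<Otimes>\<^sub>M \<Omega>)"
  proof -
    have [measurable]: "- bad_tail t m1 m2 \<in> sets \<Omega>"
      using sets.compl_sets[OF bad_tail_sets] by (simp add: Compl_eq_Diff_UNIV)
    show ?thesis by measurable
  qed
qed

text \<open>
  The likelihood differs from the product of the ratios by a factor that depends on the data only and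
  cancels in the posterior. In particular the strict inequality forces a positive evidence.
\<close>

lemma posterior_deviation:
  fixes X :: "nat \<Rightarrow> 'a"
  assumes \<eta>: "0 < \<eta>"
    and less: "(\<integral>\<^sup>+\<omega>\<in>bad_tail t m1 m2. ennreal (\<Prod>i<n. dp_density \<omega> (X i) / true_density (X i)) \<partial>\<Omega>) <
       ennreal \<eta> * (\<integral>\<^sup>+\<omega>. ennreal (\<Prod>i<n. dp_density \<omega> (X i) / true_density (X i)) \<partial>\<Omega>)"
  shows "\<bar>posterior (DP_prior \<alpha> P0) f n X (tail_event t m1 m2) - 1\<bar> \<le> \<eta>"
proof -
  let ?Bad = "bad_tail t m1 m2"
  define R where "R \<omega> = (\<Prod>i<n. dp_density \<omega> (X i) / true_density (X i))" for \<omega>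
  define qq where "qq = (\<Prod>i<n. true_density (X i))"
  have qq: "0 < qq" unfolding qq_def by (intro prod_pos) (simp add: true_density_pos)
  have R0: "0 \<le> R \<omega>" for \<omega> unfolding R_def by (intro prod_nonneg) (simp add: dp_density_nonneg less_imp_le true_density_pos)
  have L: "(\<Prod>i<n. dp_density \<omega> (X i)) = qq * R \<omega>" for \<omega>
  proof -
    have "true_density x \<noteq> 0" for x using true_density_pos[of x] by simp
    then show ?thesis by (simp add: R_def qq_def prod_dividef)
  qed
  have [measurable]: "(\<lambda>\<omega>. dp_density \<omega> x) \<in> borel_measurable \<Omega>" for x
  proof -
    have "(\<lambda>\<omega>. (\<omega>, x)) \<in> measurable \<Omega> (\<Omega> \<Otimes>\<^sub>M borel)" by measurable
    from measurable_compose[OF this measurable_dp_density] show ?thesis by simp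
  qed
  have [measurable]: "R \<in> borel_measurable \<Omega>" unfolding R_def[abs_def] by measurable
  have RI: "integrable \<Omega> R"
  proof (rule prior.integrable_const_bound)
    show "AE \<omega> in \<Omega>. norm (R \<omega>) \<le> (\<Prod>i<n. F / true_density (X i))"
      using AE_typical
    proof eventually_elim
      fix \<omega> assume "typical \<omega>"
      then show "norm (R \<omega>) \<le> (\<Prod>i<n. F / true_density (X i))"
        using R0[of \<omega>] unfolding R_def
        by (auto intro!: prod_mono divide_right_mono dp_density_le divide_nonneg_nonneg simp: dp_density_nonneg less_imp_le true_density_pos)
    qed
  qed measurable
  have BI: "integrable \<Omega> (\<lambda>\<omega>. indicator ?Bad \<omega> * R \<omega>)"
    using integrable_mult_indicator[OF bad_tail_sets RI] by simp
  define d where "d = (\<integral>\<omega>. R \<omega> \<partial>\<Omega>)"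
  define b where "b = (\<integral>\<omega>. indicator ?Bad \<omega> * R \<omega> \<partial>\<Omega>)"
  have b0: "0 \<le> b" and d0: "0 \<le> d" unfolding b_def d_def by (auto intro!: integral_nonneg_AE simp: R0)
  have D: "(\<integral>\<^sup>+\<omega>. ennreal (R \<omega>) \<partial>\<Omega>) = ennreal d"
    unfolding d_def by (intro nn_integral_eq_integral RI) (simp add: R0)
  have "(\<integral>\<^sup>+\<omega>\<in>?Bad. ennreal (R \<omega>) \<partial>\<Omega>) = (\<integral>\<^sup>+\<omega>. ennreal (indicator ?Bad \<omega> * R \<omega>) \<partial>\<Omega>)"
    by (intro nn_integral_cong) (auto split: split_indicator)
  also have "\<dots> = ennreal b"
    unfolding b_def by (intro nn_integral_eq_integral BI) (simp add: R0)
  finally have "ennreal b < ennreal \<eta> * ennreal d"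
    using less unfolding R_def[symmetric] D by simp
  then have lt: "b < \<eta> * d"
    using \<eta> b0 d0 by (simp add: ennreal_mult[symmetric] ennreal_less_iff)
  then have dpos: "0 < d" using b0 d0 \<eta> by (cases "d = 0") auto
  have "(\<integral>\<omega>. indicator (- ?Bad) \<omega> * (\<Prod>i<n. dp_density \<omega> (X i)) \<partial>\<Omega>) = (\<integral>\<omega>. qq * (R \<omega> - indicator ?Bad \<omega> * R \<omega>) \<partial>\<Omega>)"
    by (intro Bochner_Integration.integral_cong) (auto simp: L split: split_indicator)
  also have "\<dots> = qq * (d - b)"
    using RI BI by (simp add: d_def b_def)
  finally have N: "(\<integral>\<omega>. indicator (- ?Bad) \<omega> * (\<Prod>i<n. dp_density \<omega> (X i)) \<partial>\<Omega>) = qq * (d - b)" .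
  have "posterior (DP_prior \<alpha> P0) f n X (tail_event t m1 m2) = (d - b) / d"
    unfolding posterior_tail_event N using qq by (simp add: L d_def)
  then have "posterior (DP_prior \<alpha> P0) f n X (tail_event t m1 m2) - 1 = - (b / d)"
    using dpos by (simp add: field_simps)
  then have "\<bar>posterior (DP_prior \<alpha> P0) f n X (tail_event t m1 m2) - 1\<bar> = b / d"
    using dpos b0 by simp
  also have "\<dots> \<le> \<eta>" using lt dpos by (simp add: pos_divide_le_eq)
  finally show ?thesis .
qed

text \<open>
  Apply \<open>iid_posterior_concentration\<close> with \<open>h\<^sup>2 = 1 / n\<close>. In powers of \<open>1 / n\<close>, the prior mass near the
  truth has exponent \<open>e / 2\<close>, and a small tail after \<open>\<beta>lo * ln n\<close> sticks has exponent arbitrarily close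
  to \<open>\<alpha> * \<kappa>\<close>, where \<open>\<kappa> = 1 / 2 + \<delta>\<close>. The assumption on \<open>\<alpha> * \<delta>\<close> says exactly that the gap
  \<open>g = \<alpha> * \<kappa> - e / 2\<close> is positive; three quarters of it are spent on the choice of \<open>s\<close>, on \<open>\<beta>lo\<close> and on
  the evidence bound.
\<close>

lemma posterior_tail_concentration:
  assumes \<delta>: "0 < \<delta>" and \<alpha>\<delta>: "real (K - 1) + real (DIM('a) * K) < 2 * (\<alpha> * \<delta>)"
  shows "\<exists>\<beta>lo \<beta>hi. 0 < \<beta>lo \<and> \<beta>lo < \<beta>hi \<and>
     tendsto_in_probability (PiM UNIV (\<lambda>_::nat. Q))
       (\<lambda>n X. posterior (DP_prior \<alpha> P0) f n X
          (tail_event (1 / real n powr (1 / 2 + \<delta>)) (nat \<lceil>\<beta>lo * ln (real n)\<rceil>) (nat \<lceil>\<beta>hi * ln (real n)\<rceil>))) 1"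
proof -
  let ?M = "PiM UNIV (\<lambda>_::nat. Q)"
  define e where "e = \<alpha> + real (K - 1) + real (DIM('a) * K)"
  obtain c C h0 where c: "0 < c" "0 \<le> C" "0 < h0" and A: "\<And>h. 0 < h \<Longrightarrow> h \<le> h0 \<Longrightarrow> \<exists>A\<in>sets \<Omega>.
       c * h powr e \<le> measure \<Omega> A \<and>
       (AE \<omega> in \<Omega>. \<omega> \<in> A \<longrightarrow> (\<forall>x. 0 < dp_density \<omega> x / true_density x) \<and>
           (\<integral>\<^sup>+x. ennreal (1 / (dp_density \<omega> x / true_density x)) \<partial>Q) \<le> ennreal (1 + C * h\<^sup>2))"
    unfolding e_def using prior_mass_and_inverse_ratio by blast
  define \<kappa> where "\<kappa> = 1 / 2 + \<delta>"
  define g where "g = \<alpha> * \<kappa> - e / 2"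
  have g: "0 < g" using \<alpha>\<delta> unfolding g_def e_def \<kappa>_def by (simp add: algebra_simps)
  have \<kappa>: "0 < \<kappa>" using \<delta> by (simp add: \<kappa>_def)
  have \<alpha>0: "0 < \<alpha>" using \<alpha>_ge_1 by simp
  have e0: "0 \<le> e" using \<alpha>0 by (simp add: e_def)
  \<comment> \<open>The Chernoff exponent then loses \<open>g / 4\<close> against the limiting value \<open>\<alpha> * \<kappa>\<close>.\<close>
  define s where "s = \<alpha> - g / 4 / \<kappa>"
  have s\<kappa>: "s * \<kappa> = \<alpha> * \<kappa> - g / 4" using \<kappa> by (simp add: s_def field_simps)
  have "0 < s * \<kappa>" unfolding s\<kappa> using g e0 by (simp add: g_def)
  then have s: "0 < s" "s < \<alpha>" using \<kappa> g by (auto simp: zero_less_mult_iff s_def)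
  define \<rho> where "\<rho> = \<alpha> / (\<alpha> - s)"
  have \<rho>: "1 < \<rho>" using s by (simp add: \<rho>_def)
  define \<rho>' where "\<rho>' = \<alpha> / (\<alpha> + 1)"
  have \<rho>': "0 < \<rho>'" "\<rho>' < 1" using \<alpha>0 by (auto simp: \<rho>'_def)
  define \<beta>lo where "\<beta>lo = g / 4 / ln \<rho>"
  \<comment> \<open>The second bound makes the prior probability of a large tail smaller than the evidence by a factor \<open>1 / n\<close>.\<close>
  define \<beta>hi where "\<beta>hi = max (\<beta>lo + 1) ((\<kappa> + g / 4 + e / 2 + 1) / - ln \<rho>')"
  have \<beta>lo: "0 < \<beta>lo" "\<beta>lo * ln \<rho> = g / 4" using g \<rho> by (auto simp: \<beta>lo_def)
  have \<beta>hi: "\<beta>lo < \<beta>hi" by (simp add: \<beta>hi_def)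
  have \<beta>hi': "\<beta>hi * ln \<rho>' \<le> - (\<kappa> + g / 4 + e / 2 + 1)"
  proof -
    have "(\<kappa> + g / 4 + e / 2 + 1) / - ln \<rho>' \<le> \<beta>hi" by (simp add: \<beta>hi_def)
    then show ?thesis using \<rho>' by (subst (asm) pos_divide_le_eq) auto
  qed
  let ?post = "\<lambda>n X. posterior (DP_prior \<alpha> P0) f n X
          (tail_event (1 / real n powr \<kappa>) (nat \<lceil>\<beta>lo * ln (real n)\<rceil>) (nat \<lceil>\<beta>hi * ln (real n)\<rceil>))"
  have conv: "(\<lambda>n. measure ?M {X \<in> space ?M. \<bar>?post n X - 1\<bar> > \<eta>}) \<longlonglongrightarrow> 0" if \<eta>: "0 < \<eta>" for \<eta>
  proof (rule tendsto_sandwich[where f="\<lambda>_. 0"])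
    let ?u = "\<lambda>n::nat. 1 / (\<eta> * c) * (\<rho> * real n powr (- g / 4) + real n powr (- 1)) + exp C * real n powr (- g / 4)"
    have z: "(\<lambda>n::nat. real n powr (- a)) \<longlonglongrightarrow> 0" if "0 < a" for a
      using tendsto_neg_powr[OF _ filterlim_real_sequentially, of "- a"] that by simp
    have "?u \<longlonglongrightarrow> 1 / (\<eta> * c) * (\<rho> * 0 + 0) + exp C * 0"
      using z[of "g / 4"] z[of 1] g by (intro tendsto_intros) auto
    then show "?u \<longlonglongrightarrow> 0" by simp
    have "eventually (\<lambda>n::nat. real n powr (- (1 / 2)) < h0) sequentially"
      using order_tendstoD(2)[OF z[of "1 / 2"] c(3)] by simp
    with eventually_gt_at_top[of 0]
    show "eventually (\<lambda>n. measure ?M {X \<in> space ?M. \<bar>?post n X - 1\<bar> > \<eta>} \<le> ?u n) sequentially"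
    proof eventually_elim
      fix n :: nat assume n: "0 < n" and hn: "real n powr (- (1 / 2)) < h0"
      define h where "h = real n powr (- (1 / 2))"
      have h: "0 < h" "h \<le> h0" using n hn by (auto simp: h_def)
      have h2: "h\<^sup>2 = 1 / real n"
        using n by (simp add: h_def power2_eq_square powr_add[symmetric] powr_minus_divide)
      from A[OF h] obtain A where A: "A \<in> sets \<Omega>" "c * h powr e \<le> measure \<Omega> A"
        and Ap: "AE \<omega> in \<Omega>. \<omega> \<in> A \<longrightarrow> (\<forall>x. 0 < dp_density \<omega> x / true_density x)"
        and Ai: "AE \<omega> in \<Omega>. \<omega> \<in> A \<longrightarrow> (\<integral>\<^sup>+x. ennreal (1 / (dp_density \<omega> x / true_density x)) \<partial>Q) \<le> ennreal (1 + C * h\<^sup>2)"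
        by (auto simp: imp_conjR eventually_conj_iff)
      have ch: "0 < c * h powr e" using c h by simp
      define t where "t = 1 / real n powr \<kappa>"
      define m1 where "m1 = nat \<lceil>\<beta>lo * ln (real n)\<rceil>"
      define m2 where "m2 = nat \<lceil>\<beta>hi * ln (real n)\<rceil>"
      define a where "a = real n powr (- g / 4)"
      have t: "0 < t" and a: "0 < a" using n by (auto simp: t_def a_def)
      have n1: "1 \<le> real n" using n by simp
      have r1: "AE \<omega> in \<Omega>. (\<integral>\<^sup>+x. ennreal (dp_density \<omega> x / true_density x) \<partial>Q) \<le> 1"
        using AE_typical by eventually_elim (simp add: nn_integral_dp_density_ratio)
      have meas: "(\<lambda>(\<omega>, x). dp_density \<omega> x / true_density x) \<in> borel_measurable (\<Omega> \<Otimes>\<^sub>M Q)"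
        by measurable
      have "measure ?M {X \<in> space ?M. \<bar>posterior (DP_prior \<alpha> P0) f n X (tail_event t m1 m2) - 1\<bar> > \<eta>}
         \<le> measure \<Omega> (bad_tail t m1 m2) / (\<eta> * a * measure \<Omega> A) + a * (1 + C * h\<^sup>2) ^ n"
      proof (rule iid_posterior_concentration[OF prob_space_Q prior.prob_space_axioms meas A(1) bad_tail_sets _ r1 Ap Ai _ a \<eta>])
        show "0 \<le> dp_density \<omega> x / true_density x" for \<omega> x by (simp add: dp_density_nonneg less_imp_le true_density_pos)
        show "0 < measure \<Omega> A" using ch A(2) by linarith
        show "0 \<le> 1 + C * h\<^sup>2" using c by simp
        show "{X \<in> space ?M. \<eta> < \<bar>posterior (DP_prior \<alpha> P0) f n X (tail_event t m1 m2) - 1\<bar>}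
          \<subseteq> {X \<in> space ?M. \<not> ((\<integral>\<^sup>+\<omega>\<in>bad_tail t m1 m2. ennreal (\<Prod>i<n. dp_density \<omega> (X i) / true_density (X i)) \<partial>\<Omega>) <
               ennreal \<eta> * (\<integral>\<^sup>+\<omega>. ennreal (\<Prod>i<n. dp_density \<omega> (X i) / true_density (X i)) \<partial>\<Omega>))}"
          using posterior_deviation[where t=t and ?m1.0=m1 and ?m2.0=m2 and n=n, OF \<eta>] by force
      qed
      also have "\<dots> \<le> (\<rho> * real n powr (g / 4 - s * \<kappa>) + real n powr (- (g / 4 + e / 2 + 1))) / (\<eta> * a * (c * h powr e)) + a * exp C"
      proof (rule add_mono[OF frac_le mult_left_mono])
        have "measure \<Omega> (bad_tail t m1 m2) \<le> \<rho> ^ m1 * t powr s + \<rho>' ^ m2 / t"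
          using prob_bad_tail_le[OF s t] by (simp add: \<rho>_def \<rho>'_def)
        also have "\<rho> ^ m1 * t powr s \<le> (\<rho> * real n powr (\<beta>lo * ln \<rho>)) * t powr s"
          unfolding m1_def using \<rho> \<beta>lo n1 by (intro mult_right_mono power_nat_ceiling_le) auto
        also have "\<dots> = \<rho> * real n powr (g / 4 - s * \<kappa>)"
          using n by (simp add: t_def \<beta>lo powr_divide powr_powr powr_diff mult.commute)
        also have "\<rho>' ^ m2 / t \<le> real n powr (\<beta>hi * ln \<rho>') / t"
          unfolding m2_def using \<rho>' \<beta>lo \<beta>hi n1 t by (intro divide_right_mono power_nat_ceiling_ge) auto
        also have "\<dots> = real n powr (\<beta>hi * ln \<rho>' + \<kappa>)"
          by (simp add: t_def powr_add)
        also have "\<dots> \<le> real n powr (- (g / 4 + e / 2 + 1))"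
          using \<beta>hi' n1 by (intro powr_mono) auto
        finally show "measure \<Omega> (bad_tail t m1 m2) \<le> \<rho> * real n powr (g / 4 - s * \<kappa>) + real n powr (- (g / 4 + e / 2 + 1))"
          by simp
        show "\<eta> * a * (c * h powr e) \<le> \<eta> * a * measure \<Omega> A"
          using A(2) \<eta> a by (intro mult_left_mono) auto
        show "0 < \<eta> * a * (c * h powr e)" using \<eta> a ch by simp
        show "0 \<le> \<rho> * real n powr (g / 4 - s * \<kappa>) + real n powr (- (g / 4 + e / 2 + 1))" using \<rho> by simp
        have "(1 + C * h\<^sup>2) ^ n \<le> (exp (C * h\<^sup>2)) ^ n"
          using c by (intro power_mono exp_ge_add_one_self) auto
        also have "\<dots> = exp C" using n by (simp add: exp_of_nat_mult[symmetric] h2)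
        finally show "(1 + C * h\<^sup>2) ^ n \<le> exp C" .
        show "0 \<le> a" using a by simp
      qed
      also have "\<dots> = ?u n"
      proof -
        have ah: "a * h powr e = real n powr (- g / 4 - e / 2)"
          using n by (simp add: a_def h_def powr_powr powr_add[symmetric])
        have 1: "real n powr (g / 4 - s * \<kappa>) / (a * h powr e) = real n powr (- g / 4)"
          unfolding ah powr_diff[symmetric] s\<kappa> by (rule arg_cong[of _ _ "\<lambda>y. real n powr y"]) (simp add: g_def field_simps)
        have 2: "real n powr (- (g / 4 + e / 2 + 1)) / (a * h powr e) = real n powr (- 1)"
          unfolding ah powr_diff[symmetric] by (rule arg_cong[of _ _ "\<lambda>y. real n powr y"]) simp
        have "(\<rho> * real n powr (g / 4 - s * \<kappa>) + real n powr (- (g / 4 + e / 2 + 1))) / (\<eta> * a * (c * h powr e)) =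
           1 / (\<eta> * c) * (\<rho> * (real n powr (g / 4 - s * \<kappa>) / (a * h powr e)) + real n powr (- (g / 4 + e / 2 + 1)) / (a * h powr e))"
          using \<eta> a c h by (simp add: field_simps)
        then show ?thesis unfolding 1 2 by (simp add: a_def mult.commute)
      qed
      finally show "measure ?M {X \<in> space ?M. \<bar>?post n X - 1\<bar> > \<eta>} \<le> ?u n"
        by (simp add: t_def m1_def m2_def)
    qed
  qed auto
  show ?thesis
    using \<beta>lo(1) \<beta>hi conv measurable_posterior unfolding tendsto_in_probability_def \<kappa>_def by blast
qed

end

lemma mixture_kernel_of_log_growth:
  fixes f :: "'a::euclidean_space \<Rightarrow> real"
  assumes f: "f \<in> borel_measurable borel" "prob_space (density lborel (\<lambda>x. ennreal (f x)))"
    and smooth: "kernel_C3_bounded f" and growth: "kernel_log_growth f" and B: "0 \<le> B"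
  obtains F G where "mixture_kernel f F B G"
proof -
  from smooth obtain F where diff: "f differentiable_on UNIV" and F: "\<And>x. 0 < f x" "\<And>x. f x < F"
    by (auto simp: kernel_C3_bounded_def C3_def)
  from growth obtain R \<gamma> where R: "0 < R" "0 \<le> \<gamma>"
    and D: "\<And>x. norm (Deriv (\<lambda>y. ln (f y)) x) \<le> R * (1 + norm x) powr \<gamma>"
    and int: "\<And>M. 0 < M \<Longrightarrow> integrable lborel (\<lambda>x. exp (M * norm x powr \<gamma>) * f x)"
    unfolding kernel_log_growth_def by blast
  define G where "G x = R * (1 + B + norm x) powr \<gamma>" for x :: 'a
  have ratio: "f (x - \<theta>) \<le> f (x - \<theta>') * exp (norm (\<theta> - \<theta>') * G x)"
    if "norm \<theta> \<le> B" "norm \<theta>' \<le> B" for x \<theta> \<theta>'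
    unfolding G_def using R that by (intro kernel_ratio_bound[OF diff F(1) D]) auto
  have ratio0: "f (x - \<theta>) \<le> f x * exp (B * (R * (1 + B + norm x) powr \<gamma>))" if "norm \<theta> \<le> B" for x \<theta>
  proof -
    have "f (x - \<theta>) \<le> f x * exp (norm \<theta> * G x)" using ratio[OF that, of 0 x] B by simp
    also have "\<dots> \<le> f x * exp (B * G x)"
      using that R F(1)[of x] by (intro mult_left_mono) (auto intro!: mult_right_mono simp: G_def)
    finally show ?thesis by (simp add: G_def)
  qed
  have "mixture_kernel f F B G"
  proof
    interpret f: prob_space "density lborel (\<lambda>x. ennreal (f x))" by (rule f)
    show "(\<integral>\<^sup>+x. ennreal (f x) \<partial>lborel) = 1"
      using f.emeasure_space_1 f(1) by (simp add: emeasure_density)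
    show "G \<in> borel_measurable borel" unfolding G_def by measurable
    fix x :: 'a
    show "0 < f x" "f x \<le> F" "0 \<le> G x" using F[of x] R by (auto simp: G_def)
    fix \<theta> \<theta>' :: 'a assume \<theta>: "norm \<theta> \<le> B"
    show "integrable lborel (\<lambda>x. exp (M * G x) * f (x - \<theta>))" if "0 < M" for M
      using exp_growth_moment_finite[OF f(1) F(1) ratio0 int R B \<theta>, of "M * R"] that R
      by (simp add: G_def mult.assoc)
    assume "norm \<theta>' \<le> B"
    with \<theta> show "f (x - \<theta>) \<le> f (x - \<theta>') * exp (norm (\<theta> - \<theta>') * G x)" by (rule ratio)
  qed (use f B in auto)
  then show thesis by (rule that)
qed

theorem theorem3:
  fixes K :: nat and \<delta> :: real
  assumes "\<delta> > 0"
  shows "\<exists>\<alpha>star::real. \<alpha>star > 0 \<and>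
    (\<forall>(f :: real ^ 'd \<Rightarrow> real) (wstar :: nat \<Rightarrow> real) (\<theta>star :: nat \<Rightarrow> real ^ 'd)
       (\<Theta> :: (real ^ 'd) set) (P0 :: (real ^ 'd) measure) (p0 :: real ^ 'd \<Rightarrow> real) (Q :: (real ^ 'd) measure).
       f \<in> borel_measurable borel \<and> prob_space (density lborel (\<lambda>x. ennreal (f x))) \<and>
       finite_mixing K wstar \<theta>star \<and>
       Q = density lborel (\<lambda>x. ennreal (mixture f (atomic_measure {..<K} wstar \<theta>star) x)) \<and>
       compact \<Theta> \<and> (\<forall>k<K. \<theta>star k \<in> \<Theta>) \<and> (\<forall>k<K. thick_at \<Theta> (\<theta>star k)) \<and>
       prob_space P0 \<and> has_continuous_bounded_density_on P0 p0 \<Theta> \<and> (\<forall>k<K. p0 (\<theta>star k) > 0) \<and>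
       kernel_C3_bounded f \<and> kernel_log_growth f \<and> kernel_derivative_decay f
       \<longrightarrow>
       (\<forall>\<alpha>>\<alpha>star. \<exists>\<beta>lo \<beta>hi. 0 < \<beta>lo \<and> \<beta>lo < \<beta>hi \<and>
          tendsto_in_probability (PiM UNIV (\<lambda>_::nat. Q))
            (\<lambda>n X. posterior (DP_prior \<alpha> P0) f n X
               {(w, \<theta>). weight_tail w (nat \<lceil>\<beta>lo * ln (real n)\<rceil>) > 1 / real n powr (1 / 2 + \<delta>) \<and>
                        weight_tail w (nat \<lceil>\<beta>hi * ln (real n)\<rceil>) < 1 / real n powr (1 / 2 + \<delta>)})
            1))"
proof -
  \<comment> \<open>The summand \<open>1\<close> ensures \<open>1 \<le> \<alpha>\<close>, so that the Beta density is monotone; the fraction dominates the parametric cost divided by \<open>\<delta>\<close>.\<close>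
  define astar where "astar = (real K + real (CARD('d) * K)) / (2 * \<delta>) + 1"
  have astar: "0 < astar" using assms by (simp add: astar_def add_nonneg_pos)
  show ?thesis
  proof (rule exI[of _ astar], rule conjI[OF astar], intro allI impI, elim conjE)
    fix f :: "real ^ 'd \<Rightarrow> real" and wstar :: "nat \<Rightarrow> real" and \<theta>star :: "nat \<Rightarrow> real ^ 'd"
      and \<Theta> :: "(real ^ 'd) set" and P0 :: "(real ^ 'd) measure" and p0 :: "real ^ 'd \<Rightarrow> real"
      and Q :: "(real ^ 'd) measure" and \<alpha> :: real
    assume f: "f \<in> borel_measurable borel" "prob_space (density lborel (\<lambda>x. ennreal (f x)))"
      and truth: "finite_mixing K wstar \<theta>star"
      and Q: "Q = density lborel (\<lambda>x. ennreal (mixture f (atomic_measure {..<K} wstar \<theta>star) x))"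
      and \<Theta>: "compact \<Theta>" "\<forall>k<K. \<theta>star k \<in> \<Theta>" "\<forall>k<K. thick_at \<Theta> (\<theta>star k)"
      and P0: "prob_space P0" "has_continuous_bounded_density_on P0 p0 \<Theta>" "\<forall>k<K. p0 (\<theta>star k) > 0"
      and k: "kernel_C3_bounded f" "kernel_log_growth f"
      and \<alpha>: "astar < \<alpha>"
    obtain B where B: "0 \<le> B" "\<And>x. x \<in> \<Theta> \<Longrightarrow> norm x \<le> B"
      using compact_imp_bounded[OF \<Theta>(1)] unfolding bounded_pos by (metis less_imp_le)
    obtain F G where "mixture_kernel f F B G"
      using mixture_kernel_of_log_growth[OF f k B(1)] by blast
    then interpret mixture_kernel f F B G .
    interpret dp_mixture f F B G K wstar \<theta>star \<alpha> P0 p0 \<Theta>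
    proof (intro dp_mixture.intro finite_mixture_truth.intro finite_mixture_truth_axioms.intro dp_mixture_axioms.intro)
      show "mixture_kernel f F B G" by (rule mixture_kernel_axioms)
      show "prob_space P0" by (rule P0)
      show "1 \<le> \<alpha>"
      proof -
        have "0 \<le> (real K + real (CARD('d) * K)) / (2 * \<delta>)" using assms by simp
        then show ?thesis using \<alpha> by (simp add: astar_def)
      qed
    qed (simp_all add: truth \<Theta> P0 B subset_iff)
    have Q_eq: "density lborel (\<lambda>x. ennreal (true_density x)) = Q" by (simp add: Q true_density_def)
    have "real (K - 1) + real (DIM(real ^ 'd) * K) < 2 * (\<alpha> * \<delta>)"
    proof -
      have "(real K + real (CARD('d) * K)) / (2 * \<delta>) < \<alpha>" using \<alpha> by (simp add: astar_def)
      then have "real K + real (CARD('d) * K) < \<alpha> * (2 * \<delta>)" using assms by (simp add: pos_divide_less_eq)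
      then show ?thesis by simp
    qed
    from posterior_tail_concentration[OF assms this]
    show "\<exists>\<beta>lo \<beta>hi. 0 < \<beta>lo \<and> \<beta>lo < \<beta>hi \<and>
          tendsto_in_probability (PiM UNIV (\<lambda>_::nat. Q))
            (\<lambda>n X. posterior (DP_prior \<alpha> P0) f n X
               {(w, \<theta>). weight_tail w (nat \<lceil>\<beta>lo * ln (real n)\<rceil>) > 1 / real n powr (1 / 2 + \<delta>) \<and>
                        weight_tail w (nat \<lceil>\<beta>hi * ln (real n)\<rceil>) < 1 / real n powr (1 / 2 + \<delta>)})
            1"
      unfolding Q_eq .
  qed
qed

end
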